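(* Let $\Phi^*,\Psi^*$ be the $\mathbf{SO}(n)$-invariant, $\mathbb C^{n\times n}$-valued maps defined on the special unitary group $\mathbf{SU}(n)$, where $\Phi^*:x\mapsto xx^t$, $\Phi^*=[\phi^*_{kl}]_{k,l=1}^n$, and the components $\psi^*_{kl}:\mathbf{SU}(n)\to\mathbb C$ of $\Psi^*$ satisfy $$\psi^*_{kl}=\sqrt{\phi^*_{kk}\phi^*_{ll}-(\phi^*_{kl})^2},$$ where the complex square root is the standard (principal) extension of the classical real root. If $k\neq l$, then the $\mathbf{SO}(n)$-invariant complex-valued map $$(\phi^*_{kl}+i\psi^*_{kl})/\phi^*_{ll}$$ is a harmonic morphism defined on the open subset $$\widehat W^*_{kl}=\{x\in\mathbf{SU}(n)\ |\ \phi^*_{ll}(x)\neq 0,\ \phi^*_{kk}(x)\phi^*_{ll}(x)-\phi^*_{kl}(x)^2\notin(-\infty,0]\}$$ of $\mathbf{SU}(n)$, inducing a harmonic morphism locally defined on the open subset $\widehat W^*_{kl}/\mathbf{SO}(n)$ of the irreducible Riemannian symmetric space $\mathbf{SU}(n)/\mathbf{SO}(n)$.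
   Context: A map $\phi:(M,g)\to(N,h)$ between semi-Riemannian manifolds is a harmonic morphism if for every harmonic function $f:U\to\mathbb R$ on an open subset $U\subset N$ with $\phi^{-1}(U)\neq\emptyset$, the composition $f\circ\phi:\phi^{-1}(U)\to\mathbb R$ is harmonic. For $\phi:(M,g)\to\mathbb C$ this is equivalent to $\tau(\phi)=0$ and $\kappa(\phi,\phi)=0$, where $\tau$ is the Laplacian of $(M,g)$ (extended complex linearly) and $\kappa(\phi,\psi)=g(\mathrm{grad}(\phi),\mathrm{grad}(\psi))$ with $g$ extended complex bilinearly to $T^{\mathbb C}M$. $\mathbf{SU}(n)$ carries the bi-invariant Riemannian metric induced by (a positive multiple of) the negative of its Killing form, i.e. of $(X,Y)\mapsto-\mathrm{trace}(XY)$ on $\mathfrak{su}(n)$, and $\mathbf{SU}(n)/\mathbf{SO}(n)$ carries the metric making the natural projection $\mathbf{SU}(n)\to\mathbf{SU}(n)/\mathbf{SO}(n)$ a Riemannian submersion. $\mathbf{SO}(n)$-invariance means invariance under right multiplication by elements of $\mathbf{SO}(n)$. The induced map sends $x\,\mathbf{SO}(n)$ to the value at $x$. *)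

theory Defs
  imports "HOL-Analysis.Analysis"
begin

section \<open>Differentiability on open subsets of Euclidean space\<close>

definition partial :: "'d \<Rightarrow> (real^'d \<Rightarrow> 'b) \<Rightarrow> real^'d \<Rightarrow> 'b::real_normed_vector"
  where "partial i f x = frechet_derivative f (at x) (axis i 1)"

(* Only meant for open V. *)
primrec Ck_on :: "nat \<Rightarrow> (real^'d) set \<Rightarrow> (real^'d \<Rightarrow> 'b::real_normed_vector) \<Rightarrow> bool" where
  "Ck_on 0 V f \<longleftrightarrow> continuous_on V f"
| "Ck_on (Suc k) V f \<longleftrightarrow> (\<forall>x\<in>V. f differentiable (at x)) \<and> (\<forall>i. Ck_on k V (partial i f))"

definition smooth_on :: "(real^'d) set \<Rightarrow> (real^'d \<Rightarrow> 'b::real_normed_vector) \<Rightarrow> bool"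
  where "smooth_on V f \<longleftrightarrow> (\<forall>k. Ck_on k V f)"


section \<open>Laplacian and harmonic morphisms on Riemannian manifolds\<close>

(* A d-dimensional Riemannian manifold (d = CARD('d)) is given by its topology and an atlas.
   An element (V, r, G) of the atlas is a local parametrisation r : V \<rightarrow> M on an open
   V \<subseteq> R^d together with the matrix G of the metric in these coordinates. *)
record ('a, 'd::finite) riemannian =
  mtop :: "'a topology"
  atlas :: "((real^'d) set \<times> (real^'d \<Rightarrow> 'a) \<times> (real^'d \<Rightarrow> real^'d^'d)) set"

(* Christoffel symbols (upper index m, lower indices i and j) of the Levi-Civita connection. *)
definition christoffel :: "(real^'d \<Rightarrow> real^'d^'d) \<Rightarrow> 'd \<Rightarrow> 'd \<Rightarrow> 'd \<Rightarrow> real^'d \<Rightarrow> real"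
  where "christoffel G m i j x =
    (\<Sum>l\<in>UNIV. matrix_inv (G x) $ m $ l *
      (partial i (\<lambda>y. G y $ j $ l) x + partial j (\<lambda>y. G y $ i $ l) x
        - partial l (\<lambda>y. G y $ i $ j) x)) / 2"

(* Trace of the second covariant derivative of f with respect to the metric G. *)
definition laplacian :: "(real^'d \<Rightarrow> real^'d^'d) \<Rightarrow> (real^'d \<Rightarrow> real) \<Rightarrow> real^'d \<Rightarrow> real"
  where "laplacian G f x =
    (\<Sum>i\<in>UNIV. \<Sum>j\<in>UNIV. matrix_inv (G x) $ i $ j *
      (partial i (partial j f) x - (\<Sum>m\<in>UNIV. christoffel G m i j x * partial m f x)))"

definition harmonic_on :: "('a, 'd::finite) riemannian \<Rightarrow> 'a set \<Rightarrow> ('a \<Rightarrow> real) \<Rightarrow> bool"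
  where "harmonic_on M U f \<longleftrightarrow> openin (mtop M) U \<and>
    (\<forall>(V, r, G) \<in> atlas M.
      Ck_on 2 {x\<in>V. r x \<in> U} (f \<circ> r) \<and>
      (\<forall>x\<in>V. r x \<in> U \<longrightarrow> laplacian G (f \<circ> r) x = 0))"

definition harmonic_morphism ::
    "('a, 'd::finite) riemannian \<Rightarrow> 'a set \<Rightarrow> ('b, 'e::finite) riemannian \<Rightarrow> ('a \<Rightarrow> 'b) \<Rightarrow> bool"
  where "harmonic_morphism M W N \<phi> \<longleftrightarrow>
    openin (mtop M) W \<and> \<phi> ` W \<subseteq> topspace (mtop N) \<and>
    (\<forall>U f. openin (mtop N) U \<longrightarrow> {x\<in>W. \<phi> x \<in> U} \<noteq> {} \<longrightarrow> harmonic_on N U f \<longrightarrow>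
      harmonic_on M {x\<in>W. \<phi> x \<in> U} (f \<circ> \<phi>))"

definition complex_plane :: "(complex, 2) riemannian"
  where "complex_plane =
    \<lparr>mtop = euclidean, atlas = {(UNIV, \<lambda>v. Complex (v $ 1) (v $ 2), \<lambda>_. mat 1)}\<rparr>"


section \<open>The special unitary group\<close>

definition herm :: "complex^'n^'n \<Rightarrow> complex^'n^'n"
  where "herm A = (\<chi> i j. cnj (A $ j $ i))"

definition SU :: "(complex^'n^'n) set"
  where "SU = {x. x ** herm x = mat 1 \<and> det x = 1}"

(* The real special orthogonal group, as a subgroup of SU. *)
definition SO :: "(complex^'n^'n) set"
  where "SO = {x. (\<forall>i j. x $ i $ j \<in> \<real>) \<and> x ** transpose x = mat 1 \<and> det x = 1}"

(* The Lie algebra of SO. *)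
definition so_alg :: "(complex^'n^'n) set"
  where "so_alg = {Y. (\<forall>i j. Y $ i $ j \<in> \<real>) \<and> transpose Y = - Y}"

(* The trace is real on su(n), so that Re only changes the type. *)
definition neg_trace_form :: "real \<Rightarrow> complex^'n^'n \<Rightarrow> complex^'n^'n \<Rightarrow> real"
  where "neg_trace_form c X Y = - c * Re (trace (X ** Y))"

(* For s : V \<rightarrow> SU, the derivative of s at v in direction w, translated to the Lie algebra by
   s(v)^{-1} = herm (s v). A bi-invariant metric is evaluated on tangent vectors via this. *)
definition left_derivative :: "(real^'d \<Rightarrow> complex^'n^'n) \<Rightarrow> real^'d \<Rightarrow> real^'d \<Rightarrow> complex^'n^'n"
  where "left_derivative s v w = herm (s v) ** frechet_derivative s (at v) w"

definition SU_manifold :: "real \<Rightarrow> (complex^'n^'n, 'd::finite) riemannian"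
  where "SU_manifold c =
    \<lparr>mtop = top_of_set SU,
     atlas = {(V, r, G). open V \<and> smooth_on V r \<and> r ` V \<subseteq> SU \<and>
       embedding_map (top_of_set V) (top_of_set SU) r \<and> openin (top_of_set SU) (r ` V) \<and>
       (\<forall>v\<in>V. inj (left_derivative r v)) \<and>
       G = (\<lambda>v. \<chi> i j. neg_trace_form c (left_derivative r v (axis i 1))
                                        (left_derivative r v (axis j 1)))}\<rparr>"


section \<open>The quotient by the special orthogonal group\<close>

definition SO_coset :: "complex^'n^'n \<Rightarrow> (complex^'n^'n) set"
  where "SO_coset x = (\<lambda>h. x ** h) ` SO"

definition SU_SO_top :: "(complex^'n^'n) set topology"
  where "SU_SO_top = topology (\<lambda>S. S \<subseteq> SO_coset ` SU \<and> openin (top_of_set SU) {x\<in>SU. SO_coset x \<in> S})"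

lemma openin_SU_SO_top:
  fixes S :: "(complex^'n^'n) set set"
  shows "openin SU_SO_top S \<longleftrightarrow> S \<subseteq> SO_coset ` SU \<and> openin (top_of_set SU) {x\<in>SU. SO_coset x \<in> S}"
proof -
  have "istopology (\<lambda>S. S \<subseteq> SO_coset ` SU \<and>
      openin (top_of_set SU) {x\<in>SU :: (complex^'n^'n) set. SO_coset x \<in> S})"
    unfolding istopology_def
  proof (intro conjI allI impI; (elim conjE)?)
    fix S T :: "(complex^'n^'n) set set"
    assume *: "openin (top_of_set SU) {x\<in>SU. SO_coset x \<in> S}"
      "openin (top_of_set SU) {x\<in>SU. SO_coset x \<in> T}"
    have "{x\<in>SU. SO_coset x \<in> S \<inter> T} = {x\<in>SU. SO_coset x \<in> S} \<inter> {x\<in>SU. SO_coset x \<in> T}"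
      by auto
    then show "openin (top_of_set SU) {x\<in>SU. SO_coset x \<in> S \<inter> T}"
      using * by (simp add: openin_Int)
  next
    fix K :: "(complex^'n^'n) set set set"
    assume *: "\<forall>S\<in>K. S \<subseteq> SO_coset ` SU \<and> openin (top_of_set SU) {x\<in>SU. SO_coset x \<in> S}"
    have "{x\<in>SU. SO_coset x \<in> \<Union>K} = (\<Union>S\<in>K. {x\<in>SU. SO_coset x \<in> S})"
      by auto
    then show "openin (top_of_set SU) {x\<in>SU. SO_coset x \<in> \<Union>K}"
      using * by auto
  qed auto
  from topology_inverse'[OF this] show ?thesis
    by (simp add: SU_SO_top_def)
qed

(* The vertical space of x \<mapsto> SO_coset x, translated to the Lie algebra, is so_alg;
   this is the component of A orthogonal to it. *)
definition horizontal :: "real \<Rightarrow> complex^'n^'n \<Rightarrow> complex^'n^'n"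
  where "horizontal c A = (THE H. A - H \<in> so_alg \<and> (\<forall>Y\<in>so_alg. neg_trace_form c H Y = 0))"

(* The parametrisations are the SO_coset \<circ> s with s : V \<rightarrow> SU smooth. Since the projection is to
   be a Riemannian submersion, the metric of the quotient is that of the horizontal components
   of the derivatives of s. *)
definition SU_SO_manifold :: "real \<Rightarrow> ((complex^'n^'n) set, 'd::finite) riemannian"
  where "SU_SO_manifold c =
    \<lparr>mtop = SU_SO_top,
     atlas = {(V, r, G). \<exists>s. r = SO_coset \<circ> s \<and> open V \<and> smooth_on V s \<and> s ` V \<subseteq> SU \<and>
       embedding_map (top_of_set V) SU_SO_top r \<and> openin SU_SO_top (r ` V) \<and>
       (\<forall>v\<in>V. inj (\<lambda>w. horizontal c (left_derivative s v w))) \<and>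
       G = (\<lambda>v. \<chi> i j. neg_trace_form c (horizontal c (left_derivative s v (axis i 1)))
                                        (horizontal c (left_derivative s v (axis j 1))))}\<rparr>"

definition SO_invariant_on :: "(complex^'n^'n) set \<Rightarrow> (complex^'n^'n \<Rightarrow> 'b) \<Rightarrow> bool"
  where "SO_invariant_on W f \<longleftrightarrow> (\<forall>x\<in>W. \<forall>h\<in>SO. x ** h \<in> W \<and> f (x ** h) = f x)"


section \<open>The maps\<close>

definition Phi :: "complex^'n^'n \<Rightarrow> complex^'n^'n"
  where "Phi x = x ** transpose x"

definition Psi :: "complex^'n^'n \<Rightarrow> complex^'n^'n"
  where "Psi x = (\<chi> k l. csqrt (Phi x $ k $ k * Phi x $ l $ l - (Phi x $ k $ l)\<^sup>2))"

definition W_hat :: "'n \<Rightarrow> 'n \<Rightarrow> (complex^'n^'n) set"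
  where "W_hat k l = {x\<in>SU. Phi x $ l $ l \<noteq> 0 \<and>
    Phi x $ k $ k * Phi x $ l $ l - (Phi x $ k $ l)\<^sup>2 \<notin> \<real>\<^sub>\<le>\<^sub>0}"

definition ratio_map :: "'n \<Rightarrow> 'n \<Rightarrow> complex^'n^'n \<Rightarrow> complex"
  where "ratio_map k l x = (Phi x $ k $ l + \<i> * Psi x $ k $ l) / Phi x $ l $ l"

end

theory Submission
  imports Defs
begin

text \<open>
  A chart \<open>r\<close> of \<open>SU(n)\<close>, and likewise \<open>P = s s\<^sup>t\<close> for a chart \<open>v \<mapsto> s(v) SO(n)\<close> of the quotient, is
  up to a constant factor an isometric immersion into the Euclidean space of complex matrices. Its
  covariant Hessian is normal to the image. Since \<open>r\<^sup>* dr\<close> takes values in \<open>su(n)\<close> and fills the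
  tangent space by a dimension count, the Hessian is \<open>(\<partial>\<^sub>i r r\<^sup>* \<partial>\<^sub>j r + \<partial>\<^sub>j r r\<^sup>* \<partial>\<^sub>i r)/2\<close>, and contraction
  with the inverse metric is the orthogonal projection onto that space. This computes \<open>\<tau>\<close> and \<open>\<kappa>\<close> on
  the entries of \<open>\<Phi> = x x\<^sup>t\<close>: they are eigenfunctions with a common eigenvalue, and
  \<open>\<kappa>(\<phi>\<^sub>a\<^sub>b, \<phi>\<^sub>p\<^sub>q) = -(2/c) (\<phi>\<^sub>a\<^sub>q \<phi>\<^sub>b\<^sub>p + \<phi>\<^sub>a\<^sub>p \<phi>\<^sub>b\<^sub>q - (2/n) \<phi>\<^sub>a\<^sub>b \<phi>\<^sub>p\<^sub>q)\<close>. The map in question is a root \<open>f\<close>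
  of \<open>\<phi>\<^sub>l\<^sub>l f\<^sup>2 - 2 \<phi>\<^sub>k\<^sub>l f + \<phi>\<^sub>k\<^sub>k\<close>, that is, \<open>e\<^sub>k - f e\<^sub>l\<close> is isotropic for \<open>\<Phi>\<close>; applying \<open>\<kappa>\<close> and \<open>\<tau>\<close> to
  this equation gives \<open>\<kappa>(f, f) = 0\<close> and \<open>\<tau>(f) = 0\<close>.
\<close>

section \<open>Partial derivatives\<close>

text \<open>Charts are arbitrary, so no adapted coordinates are at hand. Second derivatives of a
  chart are controlled only through the Gauss formula: the Christoffel terms remove their tangential
  part. The assumptions on \<open>CARD('d)\<close> and \<open>CARD('e)\<close> turn the inclusion of
  the image of the derivative in the translated Lie algebra into an equality. Why isotropy suffices:
  with \<mu> = -2/c and \<nu> = 2/n, constant vectors satisfy kappa(Phi(w,w), Phi(u,v)) = \<mu> (2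
  Phi(w,u) Phi(w,v) - \<nu> Phi(w,w) Phi(u,v)). If Phi(w,w) = 0, both the \<nu> term and the
  eigenvalue term vanish, and u = v = w gives 0. For w = e_k - f e_l, differentiating Phi(w,w) = 0
  shows that grad f is -1/(2t) times the gradient of Phi(w,w) with w frozen, where t = \<phi>_ll f -
  \<phi>_kl is nonzero on the domain.\<close>

lemma partial_has_derivative:
  "(f has_derivative D) (at x) \<Longrightarrow> partial i f x = D (axis i 1)"
  unfolding partial_def using frechet_derivative_at by metis

lemma partial_cong:
  fixes f g :: "real^'d \<Rightarrow> 'b::real_normed_vector"
  assumes "open V" "x \<in> V" "\<And>y. y \<in> V \<Longrightarrow> f y = g y"
  shows "partial i f x = partial i g x"
proof -
  have "(f has_derivative D) (at x) \<longleftrightarrow> (g has_derivative D) (at x)" for D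
    using assms has_derivative_transform_within_open[OF _ assms(1,2)] by metis
  then show ?thesis by (simp add: partial_def frechet_derivative_def)
qed

lemma frechet_derivative_eq_sum_partial:
  fixes f :: "real^'d \<Rightarrow> 'b::real_normed_vector"
  assumes "f differentiable (at x)"
  shows "frechet_derivative f (at x) h = (\<Sum>i\<in>UNIV. h $ i *\<^sub>R partial i f x)"
proof -
  interpret linear "frechet_derivative f (at x)"
    by (rule linear_frechet_derivative[OF assms])
  have "h = (\<Sum>i\<in>UNIV. h $ i *\<^sub>R axis i 1)"
    using basis_expansion[of h] by (simp add: scalar_mult_eq_scaleR)
  then have "frechet_derivative f (at x) h = frechet_derivative f (at x) (\<Sum>i\<in>UNIV. h $ i *\<^sub>R axis i 1)"
    by simp
  then show ?thesis by (simp add: sum scale partial_def)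
qed

lemma partial_linear:
  assumes "bounded_linear L" "f differentiable (at x)"
  shows "partial i (\<lambda>y. L (f y)) x = L (partial i f x)"
  unfolding partial_def[of i f]
  by (rule partial_has_derivative)
    (use assms bounded_linear.has_derivative frechet_derivative_works in blast)

lemma partial_bilinear:
  assumes "bounded_bilinear \<beta>" "f differentiable (at x)" "g differentiable (at x)"
  shows "partial i (\<lambda>y. \<beta> (f y) (g y)) x = \<beta> (f x) (partial i g x) + \<beta> (partial i f x) (g x)"
  unfolding partial_def[of i f] partial_def[of i g]
  using bounded_bilinear.FDERIV[OF assms(1)] assms(2,3)
  by (subst partial_has_derivative) (auto simp: frechet_derivative_works)

lemma partial_compose:
  fixes f :: "real^'m \<Rightarrow> 'b::real_normed_vector" and \<phi> :: "real^'d \<Rightarrow> real^'m"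
  assumes "\<phi> differentiable (at x)" "f differentiable (at (\<phi> x))"
  shows "partial i (f \<circ> \<phi>) x = (\<Sum>a\<in>UNIV. (partial i \<phi> x $ a) *\<^sub>R partial a f (\<phi> x))"
proof -
  have "(f \<circ> \<phi> has_derivative frechet_derivative f (at (\<phi> x)) \<circ> frechet_derivative \<phi> (at x)) (at x)"
    by (intro diff_chain_at) (use assms frechet_derivative_works in blast)+
  then have "partial i (f \<circ> \<phi>) x = frechet_derivative f (at (\<phi> x)) (partial i \<phi> x)"
    using partial_has_derivative[of "f \<circ> \<phi>"] by (simp add: partial_def[of i \<phi>])
  then show ?thesis by (simp add: frechet_derivative_eq_sum_partial[OF assms(2)])
qed

lemma partial_field:
  fixes f :: "real^'d \<Rightarrow> complex"
  assumes "f differentiable (at x)" "(h has_field_derivative h') (at (f x))"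
  shows "partial i (\<lambda>y. h (f y)) x = h' * partial i f x"
proof -
  have "((\<lambda>y. h (f y)) has_derivative (\<lambda>v. h' * frechet_derivative f (at x) v)) (at x)"
    using has_derivative_compose[of f _ x UNIV h "(*) h'"] assms
    by (auto simp: frechet_derivative_works has_field_derivative_def)
  then show ?thesis using partial_has_derivative by (fastforce simp: partial_def[of i f])
qed

section \<open>Calculus of \<open>Ck_on\<close> functions on open sets\<close>

lemma Ck_on_cong:
  fixes f g :: "real^'d \<Rightarrow> 'b::real_normed_vector"
  assumes "open V" "\<And>y. y \<in> V \<Longrightarrow> f y = g y" "Ck_on k V f"
  shows "Ck_on k V g"
  using assms(2,3)
proof (induction k arbitrary: f g)
  case 0
  then show ?case using continuous_on_cong by force
next
  case (Suc k)
  have "f differentiable (at x)" if "x \<in> V" for x using Suc that by auto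
  then have "g differentiable (at x)" if "x \<in> V" for x
    using that Suc(2) has_derivative_transform_within_open[OF _ assms(1)]
    unfolding differentiable_def by metis
  moreover have "Ck_on k V (partial i g)" for i
    by (rule Suc.IH[of "partial i f"], rule partial_cong[OF assms(1)]) (use Suc(2,3) in auto)
  ultimately show ?case by simp
qed

lemma Ck_on_differentiable:
  "Ck_on k V f \<Longrightarrow> k > 0 \<Longrightarrow> x \<in> V \<Longrightarrow> f differentiable (at x)"
  by (cases k) auto

lemma Ck_on_SucD: "Ck_on (Suc k) V f \<Longrightarrow> Ck_on k V f"
proof (induction k arbitrary: f)
  case 0
  then show ?case
    by (auto intro!: continuous_at_imp_continuous_on differentiable_imp_continuous_within)
qed (metis Ck_on.simps(2))

lemma Ck_on_subset: "Ck_on k V f \<Longrightarrow> U \<subseteq> V \<Longrightarrow> Ck_on k U f"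
  by (induction k arbitrary: f) (auto intro: continuous_on_subset)

lemma Ck_on_partial: "Ck_on (Suc k) V f \<Longrightarrow> Ck_on k V (partial i f)"
  by simp

lemma smooth_on_differentiable: "smooth_on V f \<Longrightarrow> x \<in> V \<Longrightarrow> f differentiable (at x)"
  unfolding smooth_on_def using Ck_on_differentiable by blast

lemma smooth_on_Ck: "smooth_on V f \<Longrightarrow> Ck_on k V f"
  by (simp add: smooth_on_def)

lemma Ck_on_const: "Ck_on k V (\<lambda>_. c)"
proof (induction k arbitrary: c)
  case (Suc k)
  have "partial i (\<lambda>_. c) = (\<lambda>_. 0)" for i :: 'a
    by (rule ext) (simp add: partial_has_derivative[of _ "\<lambda>_. 0"])
  then show ?case using Suc by simp
qed auto

lemma partial_add:
  assumes "f differentiable (at x)" "g differentiable (at x)"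
  shows "partial i (\<lambda>y. f y + g y) x = partial i f x + partial i g x"
  unfolding partial_def[of i f] partial_def[of i g]
  by (rule partial_has_derivative) (use assms frechet_derivative_works in \<open>blast intro: has_derivative_add\<close>)

lemma Ck_on_add:
  fixes f g :: "real^'d \<Rightarrow> 'b::real_normed_vector"
  assumes "open V" "Ck_on k V f" "Ck_on k V g"
  shows "Ck_on k V (\<lambda>x. f x + g x)"
  using assms(2,3)
proof (induction k arbitrary: f g)
  case (Suc k)
  have "Ck_on k V (partial i (\<lambda>x. f x + g x))" for i
    by (rule Ck_on_cong[OF assms(1), of "\<lambda>x. partial i f x + partial i g x"])
      (use Suc in \<open>auto simp: partial_add\<close>)
  then show ?case using Suc by simp
qed (auto intro: continuous_on_add)

lemma Ck_on_sum:
  fixes f :: "'i \<Rightarrow> real^'d \<Rightarrow> 'b::real_normed_vector"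
  assumes "open V" "\<And>i. i \<in> I \<Longrightarrow> Ck_on k V (f i)"
  shows "Ck_on k V (\<lambda>x. \<Sum>i\<in>I. f i x)"
  using assms(2) by (induction I rule: infinite_finite_induct) (auto simp: Ck_on_const Ck_on_add[OF assms(1)])

lemma Ck_on_linear:
  fixes f :: "real^'d \<Rightarrow> 'b::real_normed_vector"
  assumes "open V" "bounded_linear L" "Ck_on k V f"
  shows "Ck_on k V (\<lambda>x. L (f x))"
  using assms(3)
proof (induction k arbitrary: f)
  case 0
  then show ?case using assms(2) by (simp add: bounded_linear.continuous_on)
next
  case (Suc k)
  have "Ck_on k V (partial i (\<lambda>x. L (f x)))" for i
    by (rule Ck_on_cong[OF assms(1), of "\<lambda>x. L (partial i f x)"])
      (use Suc assms(2) in \<open>auto simp: partial_linear\<close>)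
  then show ?case using Suc bounded_linear_imp_differentiable[OF assms(2)] 
    by (simp add: differentiable_compose[of L])
qed

lemma Ck_on_bilinear:
  fixes f :: "real^'d \<Rightarrow> 'b::real_normed_vector" and g :: "real^'d \<Rightarrow> 'c::real_normed_vector"
  assumes "open V" "bounded_bilinear \<beta>" "Ck_on k V f" "Ck_on k V g"
  shows "Ck_on k V (\<lambda>x. \<beta> (f x) (g x))"
  using assms(3,4)
proof (induction k arbitrary: f g)
  case 0
  then show ?case using assms(2) by (simp add: bounded_bilinear.continuous_on)
next
  case (Suc k)
  have "Ck_on k V (partial i (\<lambda>x. \<beta> (f x) (g x)))" for i
    by (rule Ck_on_cong[OF assms(1), of "\<lambda>x. \<beta> (f x) (partial i g x) + \<beta> (partial i f x) (g x)"])
      (use Suc.prems assms(2) Ck_on_SucD[OF Suc.prems(1)] Ck_on_SucD[OF Suc.prems(2)] in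
        \<open>auto simp: partial_bilinear intro!: Ck_on_add[OF assms(1)] Suc.IH\<close>)
  moreover have "(\<lambda>x. \<beta> (f x) (g x)) differentiable at x" if "x \<in> V" for x
    using Suc.prems that bounded_bilinear.FDERIV[OF assms(2)] unfolding Ck_on.simps differentiable_def by blast
  ultimately show ?case by simp
qed

lemma Ck_on_mult:
  fixes f g :: "real^'d \<Rightarrow> 'b::real_normed_algebra"
  shows "open V \<Longrightarrow> Ck_on k V f \<Longrightarrow> Ck_on k V g \<Longrightarrow> Ck_on k V (\<lambda>x. f x * g x)"
  by (rule Ck_on_bilinear[OF _ bounded_bilinear_mult])

lemma Ck_on_compose:
  fixes f :: "real^'m \<Rightarrow> 'b::real_normed_vector" and \<phi> :: "real^'d \<Rightarrow> real^'m"
  assumes "open V" "\<phi> ` V \<subseteq> U" "Ck_on k U f" "Ck_on k V \<phi>"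
  shows "Ck_on k V (f \<circ> \<phi>)"
  using assms(3,4)
proof (induction k arbitrary: f)
  case 0
  then show ?case
    using assms(2) continuous_on_compose[of V \<phi> f] continuous_on_subset[of U f] by simp
next
  case (Suc k)
  have d: "\<phi> differentiable (at x)" "f differentiable (at (\<phi> x))" if "x \<in> V" for x
    using Suc.prems assms(2) that by auto
  have "Ck_on k V (\<lambda>x. \<Sum>a\<in>UNIV. (partial i \<phi> x $ a) *\<^sub>R (partial a f \<circ> \<phi>) x)" for i
    using Suc Ck_on_SucD[OF Suc.prems(2)]
    by (intro Ck_on_sum[OF assms(1)] Ck_on_bilinear[OF assms(1) bounded_bilinear_scaleR]
        Ck_on_linear[OF assms(1) bounded_linear_vec_nth]) auto
  then have "Ck_on k V (partial i (f \<circ> \<phi>))" for i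
    by (rule Ck_on_cong[OF assms(1), rotated]) (simp add: partial_compose d)
  moreover have "f \<circ> \<phi> differentiable at x" if "x \<in> V" for x
    using d that by (simp add: differentiable_chain_at)
  ultimately show ?case unfolding Ck_on.simps by blast
qed

text \<open>The last assumption lets the regularity of h o f be used for h' o f. The derivatives of
  \<open>inverse\<close> and \<open>csqrt\<close> are again expressed by \<open>inverse\<close> and
  \<open>csqrt\<close>, so for them the induction closes.\<close>

lemma Ck_on_field:
  fixes f :: "real^'d \<Rightarrow> complex"
  assumes "open V" "Ck_on k V f"
    and "\<And>z. z \<in> S \<Longrightarrow> (h has_field_derivative h' z) (at z)" "f ` V \<subseteq> S"
    and "\<And>j. j < k \<Longrightarrow> Ck_on j V (\<lambda>x. h (f x)) \<Longrightarrow> Ck_on j V (\<lambda>x. h' (f x))"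
  shows "Ck_on k V (\<lambda>x. h (f x))"
  using assms(2,5)
proof (induction k)
  case 0
  have "isCont h z" if "z \<in> S" for z using assms(3) that DERIV_isCont by blast
  then have "continuous_on (f ` V) h"
    using assms(4) by (auto intro!: continuous_at_imp_continuous_on)
  then show ?case using 0 continuous_on_compose2[of "f ` V" h V f] by auto
next
  case (Suc k)
  have IH: "Ck_on k V (\<lambda>x. h (f x))" using Suc Ck_on_SucD by auto
  have f: "f differentiable (at x)" if "x \<in> V" for x using Suc.prems that by simp
  have "Ck_on k V (partial i (\<lambda>x. h (f x)))" for i
    by (rule Ck_on_cong[OF assms(1), of "\<lambda>x. h' (f x) * partial i f x"])
      (use Suc.prems IH f assms(3,4) in \<open>auto simp: image_subset_iff 
         intro!: Ck_on_mult[OF assms(1)] partial_field[symmetric]\<close>)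
  moreover have "(\<lambda>x. h (f x)) differentiable at x" if "x \<in> V" for x
    using has_derivative_compose[of f _ x UNIV h "(*) (h' (f x))"] f[OF that] assms(3,4) that
    unfolding has_field_derivative_def differentiable_def image_subset_iff by blast
  ultimately show ?case by simp
qed

lemma Ck_on_inverse:
  fixes f :: "real^'d \<Rightarrow> complex"
  assumes "open V" "Ck_on k V f" "\<And>x. x \<in> V \<Longrightarrow> f x \<noteq> 0"
  shows "Ck_on k V (\<lambda>x. inverse (f x))"
proof (rule Ck_on_field[OF assms(1,2), where S = "-{0}" and h' = "\<lambda>z. - (inverse z * inverse z)"])
  show "(inverse has_field_derivative - (inverse z * inverse z)) (at z)" if "z \<in> -{0}" for z :: complex
    using that DERIV_inverse[of z UNIV] by (simp add: power2_eq_square)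
  show "Ck_on j V (\<lambda>x. - (inverse (f x) * inverse (f x)))" if "Ck_on j V (\<lambda>x. inverse (f x))" for j
    using that by (simp add: Ck_on_linear[OF assms(1) bounded_linear_minus[OF bounded_linear_ident]]
        Ck_on_mult[OF assms(1)])
qed (use assms in auto)

lemma Ck_on_csqrt:
  fixes f :: "real^'d \<Rightarrow> complex"
  assumes "open V" "Ck_on k V f" "\<And>x. x \<in> V \<Longrightarrow> f x \<notin> \<real>\<^sub>\<le>\<^sub>0"
  shows "Ck_on k V (\<lambda>x. csqrt (f x))"
proof (rule Ck_on_field[OF assms(1,2), where S = "-\<real>\<^sub>\<le>\<^sub>0" and h' = "\<lambda>z. inverse (2 * csqrt z)"])
  show "(csqrt has_field_derivative inverse (2 * csqrt z)) (at z)" if "z \<in> -\<real>\<^sub>\<le>\<^sub>0" for z :: complex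
    using that has_field_derivative_csqrt[of z] by simp
  show "Ck_on j V (\<lambda>x. inverse (2 * csqrt (f x)))" if "Ck_on j V (\<lambda>x. csqrt (f x))" for j
    using that assms(3) by (intro Ck_on_inverse[OF assms(1)] Ck_on_mult[OF assms(1)] Ck_on_const) (use nonpos_Reals_zero_I in force)+
qed (use assms in auto)

text \<open>The mean value theorem is applied once in direction i and once in direction j. The
  second difference is symmetric in i and j, so exchanging them expresses the same number by the
  mixed derivative in the other order.\<close>

lemma second_difference_partial:
  fixes f :: "real^'d \<Rightarrow> real"
  assumes "Ck_on 2 (ball x r) f" "0 < h" "2 * h < r"
  shows "\<exists>y\<in>cball x (2 * h). f (x + h *\<^sub>R axis i 1 + h *\<^sub>R axis j 1) - f (x + h *\<^sub>R axis i 1)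
     - f (x + h *\<^sub>R axis j 1) + f x = h\<^sup>2 * partial j (partial i f) y"
proof -
  let ?e = "\<lambda>i. axis i 1 :: real^'d"
  have C1: "f differentiable (at y)" "partial i f differentiable (at y)" if "y \<in> ball x r" for y
    using assms(1) that by (auto simp: numeral_2_eq_2)
  have D: "((\<lambda>s. g (p + s *\<^sub>R ?e i)) has_real_derivative partial i g (p + s *\<^sub>R ?e i)) (at s)"
    if "g differentiable (at (p + s *\<^sub>R ?e i))" for g :: "real^'d \<Rightarrow> real" and p s i
  proof -
    have "((\<lambda>s. g (p + s *\<^sub>R ?e i)) has_derivative (\<lambda>t. frechet_derivative g (at (p + s *\<^sub>R ?e i)) (t *\<^sub>R ?e i))) (at s)"
      by (rule has_derivative_compose[of "\<lambda>s. p + s *\<^sub>R ?e i" "\<lambda>t. t *\<^sub>R ?e i" s UNIV g])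
        (use that frechet_derivative_works in \<open>auto intro!: derivative_eq_intros\<close>)
    then show ?thesis
      by (simp add: has_field_derivative_def partial_def mult.commute[of "frechet_derivative _ _ _"]
          linear_cmul[OF linear_frechet_derivative[OF that]] mult_commute_abs)
  qed
  have le: "norm (s *\<^sub>R ?e i + t *\<^sub>R ?e j) \<le> 2 * h" if "0 \<le> s" "s \<le> h" "0 \<le> t" "t \<le> h" for s t
    by (rule norm_triangle_le) (use that in simp)
  then have B: "x + s *\<^sub>R ?e i + t *\<^sub>R ?e j \<in> cball x (2*h)" if "0 \<le> s" "s \<le> h" "0 \<le> t" "t \<le> h" for s t
    using le[OF that] norm_minus_cancel[of "s *\<^sub>R ?e i + t *\<^sub>R ?e j"] by (simp add: dist_norm add.assoc)
  then have b: "x + s *\<^sub>R ?e i + t *\<^sub>R ?e j \<in> ball x r" if "0 \<le> s" "s \<le> h" "0 \<le> t" "t \<le> h" for s t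
    using that assms(3) by fastforce
  have b0: "x + s *\<^sub>R ?e i \<in> ball x r" if "0 \<le> s" "s \<le> h" for s
    using b[of s 0] that assms(2) by simp
  obtain s where s: "0 < s" "s < h"
    "f (x + h *\<^sub>R ?e i + h *\<^sub>R ?e j) - f (x + h *\<^sub>R ?e i) - (f (x + h *\<^sub>R ?e j) - f x)
      = h * (partial i f (x + s *\<^sub>R ?e i + h *\<^sub>R ?e j) - partial i f (x + s *\<^sub>R ?e i))"
  proof -
    have "((\<lambda>s. f (x + s *\<^sub>R ?e i + h *\<^sub>R ?e j) - f (x + s *\<^sub>R ?e i)) has_real_derivative
        partial i f (x + s *\<^sub>R ?e i + h *\<^sub>R ?e j) - partial i f (x + s *\<^sub>R ?e i)) (at s)"
      if "0 \<le> s" "s \<le> h" for s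
    proof -
      have e: "x + s *\<^sub>R ?e i + h *\<^sub>R ?e j = (x + h *\<^sub>R ?e j) + s *\<^sub>R ?e i" for s by simp
      then show ?thesis using D[of f "x + h *\<^sub>R ?e j" s i] D[of f x s i] C1(1) b[of s h] b0[of s] that assms(2)
        unfolding e by (intro DERIV_diff) auto
    qed
    from MVT2[OF assms(2) this] show ?thesis using that by auto
  qed
  obtain t where t: "0 < t" "t < h"
    "partial i f (x + s *\<^sub>R ?e i + h *\<^sub>R ?e j) - partial i f (x + s *\<^sub>R ?e i + 0 *\<^sub>R ?e j)
      = (h - 0) * partial j (partial i f) (x + s *\<^sub>R ?e i + t *\<^sub>R ?e j)"
    using MVT2[OF assms(2), of "\<lambda>t. partial i f (x + s *\<^sub>R ?e i + t *\<^sub>R ?e j)"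
        "\<lambda>t. partial j (partial i f) (x + s *\<^sub>R ?e i + t *\<^sub>R ?e j)"] D C1(2) b s by force
  show ?thesis
    by (rule bexI[OF _ B[of s t]]) (use s t in \<open>auto simp: power2_eq_square algebra_simps\<close>)
qed

lemma partial_commute_real:
  fixes f :: "real^'d \<Rightarrow> real"
  assumes "open V" "x \<in> V" "Ck_on 2 V f"
  shows "partial i (partial j f) x = partial j (partial i f) x"
proof (rule ccontr)
  let ?a = "partial i (partial j f)" and ?b = "partial j (partial i f)"
  assume "?a x \<noteq> ?b x"
  then have e: "dist (?a x) (?b x) / 2 > 0" by simp
  have "Ck_on 0 V (partial i (partial j f))" for i j
    using assms(3) by (simp add: numeral_2_eq_2)
  then have "isCont ?a x" "isCont ?b x"
    using assms by (auto simp: continuous_on_eq_continuous_at)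
  then obtain r1 r2 where r12: "r1 > 0" "r2 > 0"
    "\<And>y. dist y x < r1 \<Longrightarrow> dist (?a y) (?a x) < dist (?a x) (?b x) / 2"
    "\<And>y. dist y x < r2 \<Longrightarrow> dist (?b y) (?b x) < dist (?a x) (?b x) / 2"
    using e unfolding continuous_at_eps_delta by metis
  obtain r3 where r3: "r3 > 0" "ball x r3 \<subseteq> V" using assms open_contains_ball by metis
  \<comment> \<open>Dividing by 3 leaves 2 h strictly below all three radii, so the intermediate
    points stay where each mixed derivative is close to its value at x.\<close>
  define h where "h = min r1 (min r2 r3) / 3"
  have h: "h > 0" "2 * h < r1" "2 * h < r2" "2 * h < r3" using r12 r3 by (auto simp: h_def)
  have Ck: "Ck_on 2 (ball x r3) f" using Ck_on_subset[OF assms(3) r3(2)] .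
  obtain y where y: "y \<in> cball x (2 * h)" "f (x + h *\<^sub>R axis i 1 + h *\<^sub>R axis j 1) - f (x + h *\<^sub>R axis i 1)
     - f (x + h *\<^sub>R axis j 1) + f x = h\<^sup>2 * ?b y"
    using second_difference_partial[OF Ck h(1,4)] by metis
  obtain z where z: "z \<in> cball x (2 * h)" "f (x + h *\<^sub>R axis j 1 + h *\<^sub>R axis i 1) - f (x + h *\<^sub>R axis j 1)
     - f (x + h *\<^sub>R axis i 1) + f x = h\<^sup>2 * ?a z"
    using second_difference_partial[OF Ck h(1,4)] by metis
  have "x + h *\<^sub>R axis i 1 + h *\<^sub>R axis j 1 = x + h *\<^sub>R axis j 1 + h *\<^sub>R axis i 1" by simp
  then have "f (x + h *\<^sub>R axis i 1 + h *\<^sub>R axis j 1) = f (x + h *\<^sub>R axis j 1 + h *\<^sub>R axis i 1)" by (rule arg_cong)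
  with y(2) z(2) have "h\<^sup>2 * ?a z = h\<^sup>2 * ?b y" by linarith
  then have "?a z = ?b y" using h(1) by simp
  moreover have "dist (?a z) (?a x) < dist (?a x) (?b x) / 2" "dist (?b y) (?b x) < dist (?a x) (?b x) / 2"
    using y(1) z(1) h r12(3)[of z] r12(4)[of y] by (auto simp: dist_commute)
  ultimately show False by (smt (verit) dist_commute dist_triangle2 field_sum_of_halves)
qed

text \<open>Testing against every vector u reduces the claim to real-valued functions.\<close>

lemma partial_commute:
  fixes f :: "real^'d \<Rightarrow> 'b::real_inner"
  assumes "open V" "x \<in> V" "Ck_on 2 V f"
  shows "partial i (partial j f) x = partial j (partial i f) x"
proof -
  have *: "partial i (partial j (\<lambda>y. u \<bullet> f y)) x = u \<bullet> partial i (partial j f) x" for i j u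
  proof -
    have "partial i (partial j (\<lambda>y. u \<bullet> f y)) x = partial i (\<lambda>y. u \<bullet> partial j f y) x"
      by (rule partial_cong[OF assms(1,2)], rule partial_linear)
        (use Ck_on_differentiable[OF assms(3)] in \<open>auto simp: bounded_linear_inner_right\<close>)
    also have "\<dots> = u \<bullet> partial i (partial j f) x"
      by (rule partial_linear) (use assms in \<open>auto simp: bounded_linear_inner_right numeral_2_eq_2\<close>)
    finally show ?thesis .
  qed
  have "u \<bullet> partial i (partial j f) x = u \<bullet> partial j (partial i f) x" for u
    using partial_commute_real[OF assms(1,2) Ck_on_linear[OF assms(1) bounded_linear_inner_right assms(3)], of i j u]
    by (simp add: *)
  then show ?thesis using vector_eq_ldot by blast
qed

section \<open>The complexified Laplacian and conformality operator\<close>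

definition covhess :: "(real^'d \<Rightarrow> real^'d^'d) \<Rightarrow> 'd \<Rightarrow> 'd \<Rightarrow> (real^'d \<Rightarrow> 'b) \<Rightarrow> real^'d \<Rightarrow> 'b::real_normed_vector"
  where "covhess G i j f x = partial i (partial j f) x - (\<Sum>m\<in>UNIV. christoffel G m i j x *\<^sub>R partial m f x)"

definition Lap :: "(real^'d \<Rightarrow> real^'d^'d) \<Rightarrow> (real^'d \<Rightarrow> 'b) \<Rightarrow> real^'d \<Rightarrow> 'b::real_normed_vector"
  where "Lap G f x = (\<Sum>i\<in>UNIV. \<Sum>j\<in>UNIV. matrix_inv (G x) $ i $ j *\<^sub>R covhess G i j f x)"

text \<open>The operator kappa. The product of values involves no conjugation, so on complex
  functions this is the complex bilinear extension of the metric on gradients.\<close>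

definition Kap :: "(real^'d \<Rightarrow> real^'d^'d) \<Rightarrow> (real^'d \<Rightarrow> 'b) \<Rightarrow> (real^'d \<Rightarrow> 'b) \<Rightarrow> real^'d \<Rightarrow> 'b::real_normed_algebra"
  where "Kap G f g x = (\<Sum>i\<in>UNIV. \<Sum>j\<in>UNIV. matrix_inv (G x) $ i $ j *\<^sub>R (partial i f x * partial j g x))"

lemma differentiable_linear:
  "bounded_linear L \<Longrightarrow> f differentiable (at x) \<Longrightarrow> (\<lambda>y. L (f y)) differentiable (at x)"
  by (rule differentiable_compose[of L]) (rule bounded_linear_imp_differentiable)

lemma partial_const [simp]: "partial i (\<lambda>_. c) = (\<lambda>_. 0)"
  by (rule ext) (simp add: partial_has_derivative[of _ "\<lambda>_. 0"])

lemma matrix_inv_inverse: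
  fixes A :: "'a::semiring_1^'n^'m"
  assumes "invertible A"
  shows "A ** matrix_inv A = mat 1" "matrix_inv A ** A = mat 1"
  using someI_ex[OF assms[unfolded invertible_def]] by (auto simp: matrix_inv_def)

lemma matrix_inv_eqI:
  fixes A B :: "'a::semiring_1^'n^'n"
  assumes "A ** B = mat 1" "B ** A = mat 1"
  shows "matrix_inv A = B"
  using matrix_inv_inverse[of A] assms
  by (metis invertible_def matrix_mul_assoc matrix_mul_lid matrix_mul_rid)

lemma laplacian_eq_Lap: "laplacian G f x = Lap G f x"
  by (simp add: laplacian_def Lap_def covhess_def)

lemma partial_partial_cong:
  fixes f g :: "real^'d \<Rightarrow> 'b::real_normed_vector"
  assumes "open V" "x \<in> V" "\<And>y. y \<in> V \<Longrightarrow> f y = g y"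
  shows "partial i (partial j f) x = partial i (partial j g) x"
  using assms by (intro partial_cong[OF assms(1,2)] partial_cong[OF assms(1)])

lemma Lap_cong:
  fixes f g :: "real^'d \<Rightarrow> 'b::real_normed_vector"
  assumes "open V" "x \<in> V" "\<And>y. y \<in> V \<Longrightarrow> f y = g y"
  shows "Lap G f x = Lap G g x"
  unfolding Lap_def covhess_def
  using partial_partial_cong[OF assms] partial_cong[OF assms] by simp

lemma Kap_cong:
  fixes f g :: "real^'d \<Rightarrow> 'b::real_normed_algebra"
  assumes "open V" "x \<in> V" "\<And>y. y \<in> V \<Longrightarrow> f y = g y"
  shows "Kap G f h x = Kap G g h x"
  unfolding Kap_def using partial_cong[OF assms] by simp

lemma partial_partial_linear:
  fixes f :: "real^'d \<Rightarrow> 'b::real_normed_vector"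
  assumes "open V" "x \<in> V" "bounded_linear L" "Ck_on 2 V f"
  shows "partial i (partial j (\<lambda>y. L (f y))) x = L (partial i (partial j f) x)"
proof -
  have "partial i (partial j (\<lambda>y. L (f y))) x = partial i (\<lambda>y. L (partial j f y)) x"
    by (rule partial_cong[OF assms(1,2)], rule partial_linear[OF assms(3)])
      (use Ck_on_differentiable[OF assms(4)] in auto)
  also have "\<dots> = L (partial i (partial j f) x)"
    by (rule partial_linear[OF assms(3)]) (use assms in \<open>auto simp: numeral_2_eq_2\<close>)
  finally show ?thesis .
qed

lemma covhess_linear:
  fixes f :: "real^'d \<Rightarrow> 'b::real_normed_vector"
  assumes "open V" "x \<in> V" "bounded_linear L" "Ck_on 2 V f"
  shows "covhess G i j (\<lambda>y. L (f y)) x = L (covhess G i j f x)"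
proof -
  interpret L: bounded_linear L by fact
  have "f differentiable (at x)" using Ck_on_differentiable[OF assms(4)] assms(2) by auto
  then show ?thesis
    by (simp add: covhess_def partial_partial_linear[OF assms] partial_linear[OF assms(3)]
        L.diff L.sum L.scaleR)
qed

lemma Lap_linear:
  fixes f :: "real^'d \<Rightarrow> 'b::real_normed_vector"
  assumes "open V" "x \<in> V" "bounded_linear L" "Ck_on 2 V f"
  shows "Lap G (\<lambda>y. L (f y)) x = L (Lap G f x)"
proof -
  interpret L: bounded_linear L by fact
  show ?thesis by (simp add: Lap_def covhess_linear[OF assms] L.sum L.scaleR)
qed

lemma Lap_add:
  fixes f g :: "real^'d \<Rightarrow> 'b::real_normed_vector"
  assumes "open V" "x \<in> V" "Ck_on 2 V f" "Ck_on 2 V g"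
  shows "Lap G (\<lambda>y. f y + g y) x = Lap G f x + Lap G g x"
proof -
  have d: "f differentiable (at y)" "g differentiable (at y)" if "y \<in> V" for y
    using Ck_on_differentiable[OF assms(3)] Ck_on_differentiable[OF assms(4)] that by auto
  have "partial i (partial j (\<lambda>y. f y + g y)) x = partial i (\<lambda>y. partial j f y + partial j g y) x" for i j
    by (rule partial_cong[OF assms(1,2)], rule partial_add) (use d in auto)
  moreover have "partial i (\<lambda>y. partial j f y + partial j g y) x
      = partial i (partial j f) x + partial i (partial j g) x" for i j
    by (rule partial_add) (use assms in \<open>auto simp: numeral_2_eq_2\<close>)
  ultimately show ?thesis
    by (simp add: Lap_def covhess_def partial_add d assms(2) algebra_simps sum.distrib sum_subtractf
        scaleR_right_distrib)
qed

lemma Lap_sum: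
  fixes f :: "'i \<Rightarrow> real^'d \<Rightarrow> 'b::real_normed_vector"
  assumes "open V" "x \<in> V" "\<And>i. Ck_on 2 V (f i)"
  shows "Lap G (\<lambda>y. \<Sum>i\<in>I. f i y) x = (\<Sum>i\<in>I. Lap G (f i) x)"
proof -
  have z: "Lap G (\<lambda>_. 0::'b) x = 0"
    by (simp add: Lap_def covhess_def)
  show ?thesis
    by (induction I rule: infinite_finite_induct)
      (simp_all add: z Lap_add[OF assms(1,2)] Ck_on_sum[OF assms(1)] assms(3))
qed

section \<open>Product and chain rules where the inverse metric is symmetric\<close>

context
  fixes G :: "real^'d \<Rightarrow> real^'d^'d" and V :: "(real^'d) set" and x :: "real^'d"
  assumes V: "open V" "x \<in> V"
    and sym: "\<And>i j. matrix_inv (G x) $ i $ j = matrix_inv (G x) $ j $ i"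
begin

lemma Kap_commute:
  fixes f :: "real^'d \<Rightarrow> 'b::{real_normed_algebra,comm_ring}"
  shows "Kap G f g x = Kap G g f x"
  unfolding Kap_def by (subst sum.swap) (simp add: sym mult.commute)

lemma Kap_mult_left:
  fixes f g h :: "real^'d \<Rightarrow> 'b::{real_normed_algebra,comm_ring}"
  assumes "f differentiable (at x)" "g differentiable (at x)"
  shows "Kap G (\<lambda>y. f y * g y) h x = f x * Kap G g h x + g x * Kap G f h x"
  unfolding Kap_def
  by (simp add: partial_bilinear[OF bounded_bilinear_mult assms] sum_distrib_left
      distrib_left distrib_right sum.distrib[symmetric] scaleR_right_distrib mult_ac)

lemma Kap_add_left:
  fixes f g h :: "real^'d \<Rightarrow> 'b::{real_normed_algebra,comm_ring}"
  assumes "f differentiable (at x)" "g differentiable (at x)"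
  shows "Kap G (\<lambda>y. f y + g y) h x = Kap G f h x + Kap G g h x"
  unfolding Kap_def
  by (simp add: partial_add[OF assms] distrib_right sum.distrib[symmetric] scaleR_right_distrib)

lemma Kap_cmult_left:
  fixes f h :: "real^'d \<Rightarrow> 'b::{real_normed_algebra,comm_ring}"
  assumes "f differentiable (at x)"
  shows "Kap G (\<lambda>y. c * f y) h x = c * Kap G f h x"
  unfolding Kap_def
  by (simp add: partial_linear[OF bounded_linear_mult_right assms] sum_distrib_left mult.assoc)

text \<open>The Christoffel part is of first order, hence a derivation. Only the second derivatives
  leave cross terms, and the two of them agree after contraction by \<open>sym\<close>.\<close>

lemma Lap_mult:
  fixes f g :: "real^'d \<Rightarrow> 'b::{real_normed_algebra,comm_ring_1}"
  assumes "Ck_on 2 V f" "Ck_on 2 V g"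
  shows "Lap G (\<lambda>y. f y * g y) x = f x * Lap G g x + g x * Lap G f x + 2 * Kap G f g x"
proof -
  note bm = bounded_bilinear_mult
  have d: "f differentiable (at y)" "g differentiable (at y)"
    "partial i f differentiable (at y)" "partial i g differentiable (at y)" if "y \<in> V" for y i
    using Ck_on_differentiable[OF assms(1)] Ck_on_differentiable[OF assms(2)] assms that by (auto simp: numeral_2_eq_2)
  have dd: "(\<lambda>y. f y * partial j g y) differentiable (at x)" "(\<lambda>y. partial j f y * g y) differentiable (at x)" for j
    using d[OF V(2)] by (auto intro: differentiable_mult)
  have "partial i (partial j (\<lambda>y. f y * g y)) x = partial i (\<lambda>y. f y * partial j g y + partial j f y * g y) x" for i j
    by (rule partial_cong[OF V], rule partial_bilinear[OF bm]) (use d in auto)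
  also have "\<dots> i j = f x * partial i (partial j g) x + partial i f x * partial j g x
    + (partial j f x * partial i g x + partial i (partial j f) x * g x)" for i j
    by (simp add: partial_add[OF dd] partial_bilinear[OF bm] d V)
  finally have *: "covhess G i j (\<lambda>y. f y * g y) x = f x * covhess G i j g x + g x * covhess G i j f x
     + (partial i f x * partial j g x + partial j f x * partial i g x)" for i j
    by (simp add: covhess_def partial_bilinear[OF bm d(1,2)] V algebra_simps sum.distrib
        scaleR_right_distrib sum_distrib_left)
  have "(\<Sum>i\<in>UNIV. \<Sum>j\<in>UNIV. matrix_inv (G x) $ i $ j *\<^sub>R (partial j f x * partial i g x)) = Kap G f g x"
    unfolding Kap_def by (subst sum.swap) (simp add: sym)
  then show ?thesis
    unfolding Lap_def * by (simp add: scaleR_right_distrib sum.distrib sum_distrib_left Kap_def[symmetric])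
qed

text \<open>
  With \<open>a = \<phi>\<^sub>k\<^sub>k\<close>, \<open>b = \<phi>\<^sub>l\<^sub>l\<close>, \<open>p = \<phi>\<^sub>k\<^sub>l\<close>, the root \<open>f\<close> makes \<open>e\<^sub>k - f e\<^sub>l\<close> an isotropic vector
  of the symmetric bilinear form \<open>\<Phi>\<close>, and \<open>b f - p\<close> is half of the derivative of the quadratic at \<open>f\<close>.
\<close>

lemma isotropic_root_harmonic_conformal:
  fixes a b p f :: "real^'d \<Rightarrow> complex"
  assumes C2: "Ck_on 2 V a" "Ck_on 2 V b" "Ck_on 2 V p" "Ck_on 2 V f"
    and root: "\<And>y. y \<in> V \<Longrightarrow> b y * (f y)\<^sup>2 - 2 * p y * f y + a y = 0"
    and simple_root: "b x * f x - p x \<noteq> 0"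
    and Lap: "Lap G a x = \<rho> * a x" "Lap G b x = \<rho> * b x" "Lap G p x = \<rho> * p x"
    and Kap: "Kap G a a x = \<mu> * (2 * (a x)\<^sup>2 - \<nu> * (a x)\<^sup>2)"
      "Kap G b b x = \<mu> * (2 * (b x)\<^sup>2 - \<nu> * (b x)\<^sup>2)"
      "Kap G p p x = \<mu> * ((p x)\<^sup>2 + a x * b x - \<nu> * (p x)\<^sup>2)"
      "Kap G a b x = \<mu> * (2 * (p x)\<^sup>2 - \<nu> * (a x * b x))"
      "Kap G a p x = \<mu> * (2 * (a x * p x) - \<nu> * (a x * p x))"
      "Kap G b p x = \<mu> * (2 * (b x * p x) - \<nu> * (b x * p x))"
  shows "Kap G f f x = 0" "Lap G f x = 0"
proof -
  define t where "t = b x * f x - p x"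
  have t: "t \<noteq> 0" using simple_root by (simp add: t_def)
  have d: "a differentiable (at x)" "b differentiable (at x)" "p differentiable (at x)" "f differentiable (at x)"
    using Ck_on_differentiable[of 2 V] C2 V by auto
  let ?q = "\<lambda>y. b y * (f y * f y) + ((-2) * (p y * f y) + a y)"
  have q0: "?q y = 0" if "y \<in> V" for y using root[OF that] by (simp add: power2_eq_square algebra_simps)
  have K0: "Kap G ?q h x = 0" for h
    using Kap_cong[OF V q0, where G = G and h = h] by (simp add: Kap_def)
  have L0: "Lap G ?q x = 0"
    using Lap_cong[OF V q0, where G = G] by (simp add: Lap_def covhess_def)
  have d2: "(\<lambda>y. f y * f y) differentiable (at x)" "(\<lambda>y. p y * f y) differentiable (at x)"
    "(\<lambda>y. b y * (f y * f y)) differentiable (at x)" "(\<lambda>y. (-2) * (p y * f y)) differentiable (at x)"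
    "(\<lambda>y. (-2) * (p y * f y) + a y) differentiable (at x)"
    by (intro differentiable_add differentiable_mult differentiable_const d)+
  \<comment> \<open>The terms with kappa(f, h) have the common factor 2 b f - 2 p = 2 t.\<close>
  have K: "2 * t * Kap G f h x + (f x)\<^sup>2 * Kap G b h x - 2 * f x * Kap G p h x + Kap G a h x = 0" for h
    using K0[of h] Kap_add_left[OF d2(3,5), of h] Kap_mult_left[OF d(2) d2(1), of h] Kap_mult_left[OF d(4,4), of h]
      Kap_add_left[OF d2(4) d(1), of h] Kap_cmult_left[OF d2(2), of "-2" h] Kap_mult_left[OF d(3,4), of h]
    unfolding t_def by algebra
  have Ck: "Ck_on 2 V (\<lambda>y. f y * f y)" "Ck_on 2 V (\<lambda>y. p y * f y)" "Ck_on 2 V (\<lambda>y. b y * (f y * f y))" 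
    "Ck_on 2 V (\<lambda>y. (-2) * (p y * f y))" "Ck_on 2 V (\<lambda>y. (-2) * (p y * f y) + a y)"
    by (intro Ck_on_add[OF V(1)] Ck_on_mult[OF V(1)] Ck_on_const C2)+
  have L: "2 * t * Lap G f x + (f x)\<^sup>2 * Lap G b x - 2 * f x * Lap G p x + Lap G a x
     + 2 * b x * Kap G f f x + 4 * f x * Kap G f b x - 4 * Kap G f p x = 0"
    using L0 Lap_add[OF V Ck(3,5), of G] Lap_mult[OF C2(2) Ck(1)] Lap_mult[OF C2(4,4)]
      Lap_add[OF V Ck(4) C2(1), of G] Lap_linear[OF V bounded_linear_mult_right Ck(2), of G "-2"] Lap_mult[OF C2(3,4)]
      Kap_mult_left[OF d(4,4), of b] Kap_commute[of b "\<lambda>y. f y * f y"] Kap_commute[of p f] unfolding t_def by algebra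
  have qx: "a x = 2 * p x * f x - b x * (f x)\<^sup>2" using root[OF V(2)] by (simp add: algebra_simps)
  have cancel: "2 * t * u = 2 * t * v \<Longrightarrow> u = v" for u v
    using t mult_left_cancel[of "2 * t"] by simp
  \<comment> \<open>With w = e_k - f e_l, \<open>K\<close> reads 2 t kappa(f, h) = -kappa(Phi(w,w),
    h) for frozen w. Isotropy kills the terms with \<nu>, and Phi(w,e_l) = -t, Phi(w,e_k) = -f t
    give the three values.\<close>
  have "2 * t * Kap G f b x = 2 * t * (- \<mu> * t)"
    using K[of b] Kap_commute[of p b] unfolding Kap qx t_def by algebra
  then have fb: "Kap G f b x = - \<mu> * t" by (rule cancel)
  have "2 * t * Kap G f p x = 2 * t * (- \<mu> * f x * t)"
    using K[of p] unfolding Kap qx t_def by algebra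
  then have fp: "Kap G f p x = - \<mu> * f x * t" by (rule cancel)
  have "2 * t * Kap G f a x = 2 * t * (- \<mu> * (f x)\<^sup>2 * t)"
    using K[of a] Kap_commute[of p a] Kap_commute[of b a] unfolding Kap qx t_def by algebra
  then have fa: "Kap G f a x = - \<mu> * (f x)\<^sup>2 * t" by (rule cancel)
  have "2 * t * Kap G f f x = 0"
    using K[of f] Kap_commute[of p f] Kap_commute[of b f] Kap_commute[of a f] unfolding fa fb fp by algebra
  then show "Kap G f f x = 0" using t by simp
  \<comment> \<open>The eigenvalue \<rho> multiplies Phi(w,w) = 0, and the cross terms 4 f
    kappa(f,b) and -4 kappa(f,p) cancel.\<close>
  then have "2 * t * Lap G f x = 0"
    using L unfolding fb fp Lap qx by algebra
  then show "Lap G f x = 0" using t by simp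
qed

lemma Lap_compose:
  fixes f :: "real^'m \<Rightarrow> real" and w :: "real^'d \<Rightarrow> real^'m"
  assumes w: "w ` V \<subseteq> U" "Ck_on 2 V w" "Ck_on 2 U f"
  shows "Lap G (f \<circ> w) x = (\<Sum>a\<in>UNIV. Lap G w x $ a * partial a f (w x))
    + (\<Sum>a\<in>UNIV. \<Sum>b\<in>UNIV. partial b (partial a f) (w x) * Kap G (\<lambda>y. w y $ b) (\<lambda>y. w y $ a) x)"
proof -
  have d: "w differentiable (at y)" "partial i w differentiable (at y)"
    "f differentiable (at (w y))" "partial a f differentiable (at (w y))"  if "y \<in> V" for y i a
    using w that by (auto simp: numeral_2_eq_2)
  have dc: "(\<lambda>y. partial j w y $ a) differentiable (at x)" "(partial a f \<circ> w) differentiable (at x)" for j a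
    using d[OF V(2)] differentiable_linear[OF bounded_linear_vec_nth, of "partial j w" x a]
    by (simp_all add: differentiable_chain_at)
  have wc: "partial i (\<lambda>y. w y $ a) x = partial i w x $ a" for i a
    by (rule partial_linear[OF bounded_linear_vec_nth]) (use d V in auto)
  have 1: "partial j (f \<circ> w) y = (\<Sum>a\<in>UNIV. partial j w y $ a * (partial a f \<circ> w) y)" if "y \<in> V" for y j
    using partial_compose[OF d(1,3)] that by simp
  have psum: "partial i (\<lambda>y. \<Sum>a\<in>I. h a y) x = (\<Sum>a\<in>I. partial i (h a) x)"
    if "\<And>a. h a differentiable (at x)" for I :: "'m set" and h :: "'m \<Rightarrow> real^'d \<Rightarrow> real" and i
  proof -
    have "((\<lambda>y. \<Sum>a\<in>I. h a y) has_derivative (\<lambda>v. \<Sum>a\<in>I. frechet_derivative (h a) (at x) v)) (at x)"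
      by (intro has_derivative_sum) (use that frechet_derivative_works in blast)
    then show ?thesis by (simp add: partial_has_derivative partial_def[of i "h _"])
  qed
  have 2: "partial i (partial j (f \<circ> w)) x = (\<Sum>a\<in>UNIV. partial i (partial j w) x $ a * partial a f (w x))
     + (\<Sum>a\<in>UNIV. \<Sum>b\<in>UNIV. partial b (partial a f) (w x) * (partial i w x $ b * partial j w x $ a))" for i j
  proof -
    have "partial i (partial j (f \<circ> w)) x = partial i (\<lambda>y. \<Sum>a\<in>UNIV. partial j w y $ a * (partial a f \<circ> w) y) x"
      by (rule partial_cong[OF V 1])
    also have "\<dots> = (\<Sum>a\<in>UNIV. partial i (\<lambda>y. partial j w y $ a * (partial a f \<circ> w) y) x)"
      by (rule psum) (rule differentiable_mult[OF dc])
    also have "\<dots> = (\<Sum>a\<in>UNIV. partial j w x $ a * partial i (partial a f \<circ> w) x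
        + partial i (partial j w) x $ a * (partial a f \<circ> w) x)"
      by (simp only: partial_bilinear[OF bounded_bilinear_mult dc] 
          partial_linear[OF bounded_linear_vec_nth d(2)[OF V(2)]])
    finally show ?thesis
      by (simp add: partial_compose[OF d(1,4)] V sum.distrib sum_distrib_left mult_ac)
  qed
  have 3: "covhess G i j (f \<circ> w) x = (\<Sum>a\<in>UNIV. covhess G i j w x $ a * partial a f (w x))
     + (\<Sum>a\<in>UNIV. \<Sum>b\<in>UNIV. partial b (partial a f) (w x) * (partial i w x $ b * partial j w x $ a))" for i j
  proof -
    have "(\<Sum>m\<in>UNIV. christoffel G m i j x * (\<Sum>a\<in>UNIV. partial m w x $ a * partial a f (w x)))
        = (\<Sum>a\<in>UNIV. (\<Sum>m\<in>UNIV. christoffel G m i j x * partial m w x $ a) * partial a f (w x))"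
      by (subst sum_distrib_right, subst sum.swap) (simp add: sum_distrib_left mult.assoc)
    then show ?thesis
      by (simp add: covhess_def 1 2 V left_diff_distrib sum_subtractf)
  qed
  have "Lap G (f \<circ> w) x = (\<Sum>i\<in>UNIV. \<Sum>j\<in>UNIV. \<Sum>a\<in>UNIV. matrix_inv (G x) $ i $ j * (covhess G i j w x $ a * partial a f (w x)))
    + (\<Sum>i\<in>UNIV. \<Sum>j\<in>UNIV. \<Sum>a\<in>UNIV. \<Sum>b\<in>UNIV. matrix_inv (G x) $ i $ j * 
        (partial b (partial a f) (w x) * (partial i w x $ b * partial j w x $ a)))"
    by (simp add: Lap_def 3 distrib_left sum.distrib sum_distrib_left)
  also have "(\<Sum>i\<in>UNIV. \<Sum>j\<in>UNIV. \<Sum>a\<in>UNIV. matrix_inv (G x) $ i $ j * (covhess G i j w x $ a * partial a f (w x)))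
     = (\<Sum>a\<in>UNIV. \<Sum>i\<in>UNIV. \<Sum>j\<in>UNIV. matrix_inv (G x) $ i $ j * (covhess G i j w x $ a * partial a f (w x)))"
    by (subst (2) sum.swap, subst sum.swap) rule
  also have "\<dots> = (\<Sum>a\<in>UNIV. Lap G w x $ a * partial a f (w x))"
    by (simp add: Lap_def sum_distrib_right mult.assoc)
  also have "(\<Sum>i\<in>UNIV. \<Sum>j\<in>UNIV. \<Sum>a\<in>UNIV. \<Sum>b\<in>UNIV. matrix_inv (G x) $ i $ j * 
        (partial b (partial a f) (w x) * (partial i w x $ b * partial j w x $ a)))
     = (\<Sum>a\<in>UNIV. \<Sum>b\<in>UNIV. \<Sum>i\<in>UNIV. \<Sum>j\<in>UNIV. matrix_inv (G x) $ i $ j * 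
        (partial b (partial a f) (w x) * (partial i w x $ b * partial j w x $ a)))"
  proof -
    \<comment> \<open>Grouping the indices in pairs makes the fourfold interchange a single
      application of \<open>sum.swap\<close>.\<close>
    have swap: "(\<Sum>i\<in>UNIV. \<Sum>j\<in>UNIV. \<Sum>a\<in>UNIV. \<Sum>b\<in>UNIV. (F i j a b :: real))
       = (\<Sum>a\<in>UNIV. \<Sum>b\<in>UNIV. \<Sum>i\<in>UNIV. \<Sum>j\<in>UNIV. F i j a b)" for F :: "'d \<Rightarrow> 'd \<Rightarrow> 'm \<Rightarrow> 'm \<Rightarrow> real"
    proof -
      have "(\<Sum>p\<in>UNIV\<times>UNIV. \<Sum>q\<in>UNIV\<times>UNIV. F (fst p) (snd p) (fst q) (snd q))
         = (\<Sum>q\<in>UNIV\<times>UNIV. \<Sum>p\<in>UNIV\<times>UNIV. F (fst p) (snd p) (fst q) (snd q))"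
        by (rule sum.swap)
      then show ?thesis by (simp only: sum.cartesian_product' fst_conv snd_conv)
    qed
    show ?thesis by (rule swap)
  qed
  also have "\<dots> = (\<Sum>a\<in>UNIV. \<Sum>b\<in>UNIV. partial b (partial a f) (w x) * Kap G (\<lambda>y. w y $ b) (\<lambda>y. w y $ a) x)"
    by (simp add: Kap_def wc sum_distrib_left mult_ac)
  finally show ?thesis .
qed

end

section \<open>Pulling back harmonic functions on the complex plane\<close>

lemma laplacian_flat: "laplacian (\<lambda>_. mat 1) f x = (\<Sum>i\<in>UNIV. partial i (partial i f) x)"
proof -
  have inv: "matrix_inv (mat 1 :: real^'a^'a) = mat 1"
    by (rule matrix_inv_eqI) auto
  have "laplacian (\<lambda>_. mat 1) f x = (\<Sum>i\<in>UNIV. \<Sum>j\<in>UNIV. if i = j then partial i (partial j f) x else 0)"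
    unfolding laplacian_def christoffel_def inv
    by (intro sum.cong refl) (simp add: mat_def)
  then show ?thesis by simp
qed

text \<open>Write \<phi> = u + i v. The equation kappa(\<phi>, \<phi>) = 0 says that grad u and grad
  v are orthogonal and of equal length, so the Hessian term of the chain rule is a multiple of the
  flat Laplacian of f; the first-order term carries tau(\<phi>) = 0.\<close>

lemma harmonic_compose:
  fixes \<phi> :: "real^'d \<Rightarrow> complex" and f :: "complex \<Rightarrow> real"
  assumes V: "open V" "x \<in> V"
    and sym: "\<And>i j. matrix_inv (G x) $ i $ j = matrix_inv (G x) $ j $ i"
    and \<phi>: "Ck_on 2 V \<phi>" "\<phi> ` V \<subseteq> U" "Lap G \<phi> x = 0" "Kap G \<phi> \<phi> x = 0"
    and f: "harmonic_on complex_plane U f"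
  shows "Ck_on 2 V (f \<circ> \<phi>)" "laplacian G (f \<circ> \<phi>) x = 0"
proof -
  let ?r = "\<lambda>v::real^2. Complex (v $ 1) (v $ 2)"
  define w where "w = (\<lambda>y. vector [Re (\<phi> y), Im (\<phi> y)] :: real^2)"
  have rw: "?r (w y) = \<phi> y" for y by (simp add: w_def)
  define U' where "U' = {v. ?r v \<in> U}"
  define F where "F = f \<circ> ?r"
  have F: "Ck_on 2 U' F" "\<And>v. v \<in> U' \<Longrightarrow> laplacian (\<lambda>_. mat 1) F v = 0"
    using f by (auto simp: harmonic_on_def complex_plane_def U'_def F_def)
  have Fw: "f \<circ> \<phi> = F \<circ> w" by (simp add: F_def rw fun_eq_iff)
  define L where "L = (\<lambda>z. vector [Re z, Im z] :: real^2)"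
  have L: "bounded_linear L"
  proof (rule linear_conv_bounded_linear[THEN iffD1], rule linearI)
    show "L (y + z) = L y + L z" "L (c *\<^sub>R y) = c *\<^sub>R L y" for y z c
      by (simp_all add: L_def vec_eq_iff forall_2)
  qed
  have wL: "w = (\<lambda>y. L (\<phi> y))" by (simp add: w_def L_def)
  have w: "Ck_on 2 V w" unfolding wL by (rule Ck_on_linear[OF V(1) L \<phi>(1)])
  have wU: "w ` V \<subseteq> U'" using \<phi>(2) rw by (auto simp: U'_def)
  show "Ck_on 2 V (f \<circ> \<phi>)" unfolding Fw by (rule Ck_on_compose[OF V(1) wU F(1) w])
  have Lw: "Lap G w x = 0"
    unfolding wL using Lap_linear[OF V L \<phi>(1)] \<phi>(3) by (simp add: L_def vec_eq_iff forall_2)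
  have d: "\<phi> differentiable (at x)" using Ck_on_differentiable[OF \<phi>(1)] V by simp
  have p: "partial i (\<lambda>y. w y $ 1) x = Re (partial i \<phi> x)" "partial i (\<lambda>y. w y $ 2) x = Im (partial i \<phi> x)" for i
    unfolding w_def using partial_linear[OF bounded_linear_Re d] partial_linear[OF bounded_linear_Im d] by simp_all
  have "Re (Kap G \<phi> \<phi> x) = Kap G (\<lambda>y. w y $ 1) (\<lambda>y. w y $ 1) x - Kap G (\<lambda>y. w y $ 2) (\<lambda>y. w y $ 2) x"
    by (simp add: Kap_def p sum_subtractf right_diff_distrib)
  moreover have "Im (Kap G \<phi> \<phi> x) = Kap G (\<lambda>y. w y $ 1) (\<lambda>y. w y $ 2) x + Kap G (\<lambda>y. w y $ 2) (\<lambda>y. w y $ 1) x"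
    by (simp add: Kap_def p sum.distrib distrib_left)
  moreover have "Kap G (\<lambda>y. w y $ 1) (\<lambda>y. w y $ 2) x = Kap G (\<lambda>y. w y $ 2) (\<lambda>y. w y $ 1) x"
    by (rule Kap_commute[OF V, of G, OF sym])
  ultimately have K: "Kap G (\<lambda>y. w y $ 1) (\<lambda>y. w y $ 1) x = Kap G (\<lambda>y. w y $ 2) (\<lambda>y. w y $ 2) x"
    "Kap G (\<lambda>y. w y $ 1) (\<lambda>y. w y $ 2) x = 0" "Kap G (\<lambda>y. w y $ 2) (\<lambda>y. w y $ 1) x = 0"
    using \<phi>(4) by auto
  have "partial 1 (partial 1 F) (w x) + partial 2 (partial 2 F) (w x) = 0"
    using F(2)[of "w x"] wU V(2) by (simp add: laplacian_flat sum_2 image_subset_iff)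
  then show "laplacian G (f \<circ> \<phi>) x = 0"
    unfolding laplacian_eq_Lap Fw using Lap_compose[OF V, of G, OF sym wU w F(1)]
    by (simp add: Lw sum_2 K distrib_right[symmetric])
qed

section \<open>Isometric immersions into Euclidean space\<close>

text \<open>The factor \<open>K\<close> will be c on the group and c/4 on the quotient, where the
  embedding stretches horizontal vectors by 2.\<close>

locale isometric_immersion =
  fixes V :: "(real^'d) set" and R :: "real^'d \<Rightarrow> 'b::euclidean_space" and K :: real
    and G :: "real^'d \<Rightarrow> real^'d^'d"
  assumes V: "open V" and C2: "Ck_on 2 V R" and K: "K > 0"
    and immersion: "\<And>v. v \<in> V \<Longrightarrow> inj (frechet_derivative R (at v))"
    and G: "\<And>v. v \<in> V \<Longrightarrow> G v = (\<chi> i j. K * (partial i R v \<bullet> partial j R v))"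
begin

lemma differentiable: "v \<in> V \<Longrightarrow> R differentiable (at v)" "v \<in> V \<Longrightarrow> partial i R differentiable (at v)"
  using C2 by (auto simp: numeral_2_eq_2)

lemma gram_mult_vec:
  assumes "v \<in> V"
  shows "(G v *v w) $ i = K * (partial i R v \<bullet> frechet_derivative R (at v) w)"
  by (simp add: matrix_vector_mult_def G[OF assms] frechet_derivative_eq_sum_partial[OF differentiable(1)[OF assms]]
      inner_sum_right sum_distrib_left mult_ac)

lemma eq_zero_if_orthogonal_to_range:
  assumes "v \<in> V" "A \<in> range (frechet_derivative R (at v))" "\<And>l. A \<bullet> partial l R v = 0"
  shows "A = 0"
proof -
  obtain w where w: "A = frechet_derivative R (at v) w" using assms(2) by auto
  have "A \<bullet> A = A \<bullet> (\<Sum>i\<in>UNIV. w $ i *\<^sub>R partial i R v)"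
    using w frechet_derivative_eq_sum_partial[OF differentiable(1)[OF assms(1)]] by simp
  also have "\<dots> = 0" by (simp add: inner_sum_right assms(3))
  finally show ?thesis by simp
qed

lemma gram_invertible:
  assumes "v \<in> V"
  shows "invertible (G v)"
proof -
  have lin: "linear (frechet_derivative R (at v))"
    by (rule linear_frechet_derivative[OF differentiable(1)[OF assms]])
  have "w = 0" if "G v *v w = 0" for w
  proof -
    have "frechet_derivative R (at v) w = 0"
    proof (rule eq_zero_if_orthogonal_to_range[OF assms])
      show "frechet_derivative R (at v) w \<bullet> partial l R v = 0" for l
        using gram_mult_vec[OF assms, of w l] that K by (simp add: inner_commute)
    qed auto
    then show ?thesis using immersion[OF assms] linear_injective_0[OF lin] by blast
  qed
  then have "inj ((*v) (G v))" using linear_injective_0[OF matrix_vector_mul_linear, of "G v"] by blast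
  then show ?thesis by (simp add: matrix_left_invertible_injective[symmetric] invertible_left_inverse)
qed

lemma gram_inv_sym:
  assumes "v \<in> V"
  shows "matrix_inv (G v) $ i $ j = matrix_inv (G v) $ j $ i"
proof -
  have t: "transpose (G v) = G v" by (simp add: G[OF assms] transpose_def vec_eq_iff inner_commute)
  have "matrix_inv (G v) = transpose (matrix_inv (G v))"
    by (rule matrix_inv_eqI)
      (metis t matrix_transpose_mul transpose_mat matrix_inv_inverse gram_invertible[OF assms])+
  then have "matrix_inv (G v) $ i $ j = transpose (matrix_inv (G v)) $ i $ j" by simp
  then show ?thesis by (simp add: transpose_def)
qed

lemma partial_gram:
  assumes "v \<in> V"
  shows "partial l (\<lambda>y. G y $ i $ j) v
    = K * (partial i R v \<bullet> partial l (partial j R) v + partial l (partial i R) v \<bullet> partial j R v)"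
proof -
  have "partial l (\<lambda>y. G y $ i $ j) v = partial l (\<lambda>y. K * (partial i R y \<bullet> partial j R y)) v"
    by (rule partial_cong[OF V assms]) (simp add: G)
  also have "\<dots> = K * partial l (\<lambda>y. partial i R y \<bullet> partial j R y) v"
    by (rule partial_linear[OF bounded_linear_mult_right])
      (use differentiable(2)[OF assms] in \<open>simp add: differentiable_inner\<close>)
  finally show ?thesis
    by (simp add: partial_bilinear[OF bounded_bilinear_inner] differentiable assms)
qed

text \<open>Of the six terms produced by differentiating the Gram matrix, four cancel in pairs and
  two coincide, because mixed partial derivatives commute.\<close>

lemma christoffel_immersion:
  assumes "v \<in> V"
  shows "christoffel G m i j v = (\<Sum>l\<in>UNIV. matrix_inv (G v) $ m $ l * (K * (partial i (partial j R) v \<bullet> partial l R v)))"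
proof -
  have c: "partial a (partial b R) v = partial b (partial a R) v" for a b
    by (rule partial_commute[OF V assms C2])
  have "partial i (\<lambda>y. G y $ j $ l) v + partial j (\<lambda>y. G y $ i $ l) v - partial l (\<lambda>y. G y $ i $ j) v
     = 2 * (K * (partial i (partial j R) v \<bullet> partial l R v))" for l
    unfolding partial_gram[OF assms] c[of l i] c[of l j] c[of j i]
    by (simp add: algebra_simps inner_commute)
  then show ?thesis unfolding christoffel_def by (simp add: sum_divide_distrib)
qed

text \<open>The Gauss formula: by \<open>christoffel_immersion\<close> the subtracted sum is the
  tangential component of the second derivative.\<close>

lemma covhess_normal:
  assumes "v \<in> V"
  shows "covhess G i j R v \<bullet> partial l R v = 0"
proof -
  let ?h = "\<lambda>q. K * (partial i (partial j R) v \<bullet> partial q R v)"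
  have "K * (covhess G i j R v \<bullet> partial l R v) = ?h l - (\<Sum>m\<in>UNIV. christoffel G m i j v * G v $ m $ l)"
    by (simp add: covhess_def inner_diff_left inner_sum_left G[OF assms] algebra_simps sum_distrib_left)
  also have "(\<Sum>m\<in>UNIV. christoffel G m i j v * G v $ m $ l)
      = (\<Sum>q\<in>UNIV. ?h q * (\<Sum>m\<in>UNIV. matrix_inv (G v) $ q $ m * G v $ m $ l))"
    unfolding christoffel_immersion[OF assms] sum_distrib_right
    by (subst sum.swap) (simp add: sum_distrib_left gram_inv_sym[OF assms, of _ _] mult_ac)
  also have "\<dots> = (\<Sum>q\<in>UNIV. ?h q * (matrix_inv (G v) ** G v) $ q $ l)"
    by (simp add: matrix_matrix_mult_def)
  also have "\<dots> = (\<Sum>q\<in>UNIV. if q = l then ?h q else 0)"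
    by (rule sum.cong) (auto simp: matrix_inv_inverse[OF gram_invertible[OF assms]] mat_def)
  also have "\<dots> = ?h l" by simp
  finally show ?thesis using K by simp
qed

text \<open>The assumptions characterise Q as the orthogonal projection of C onto the tangent space.
  Both sides are tangent and have equal inner products with all tangent vectors; 1/K comes from
  inverting the metric.\<close>

lemma gram_inv_projection:
  assumes v: "v \<in> V" and Q: "Q \<in> range (frechet_derivative R (at v))" "\<And>l. (C - Q) \<bullet> partial l R v = 0"
  shows "(\<Sum>i\<in>UNIV. \<Sum>j\<in>UNIV. (matrix_inv (G v) $ i $ j * (C \<bullet> partial j R v)) *\<^sub>R partial i R v) = (1 / K) *\<^sub>R Q"
    (is "?S = _")
proof -
  have lin: "linear (frechet_derivative R (at v))"
    by (rule linear_frechet_derivative[OF differentiable(1)[OF v]])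
  have "?S - (1 / K) *\<^sub>R Q = 0"
  proof (rule eq_zero_if_orthogonal_to_range[OF v])
    have p: "partial i R v \<in> range (frechet_derivative R (at v))" for i
      by (simp add: partial_def)
    have "subspace (range (frechet_derivative R (at v)))"
      using linear_subspace_image[OF lin subspace_UNIV] .
    then show "?S - (1 / K) *\<^sub>R Q \<in> range (frechet_derivative R (at v))"
      using p Q(1) by (intro subspace_diff subspace_sum subspace_scale)
    fix l
    define g where "g = matrix_inv (G v)"
    have gs: "g $ i $ j = g $ j $ i" for i j unfolding g_def by (rule gram_inv_sym[OF v])
    have "K * (?S \<bullet> partial l R v) = (\<Sum>i\<in>UNIV. \<Sum>j\<in>UNIV. g $ i $ j * (C \<bullet> partial j R v) * G v $ i $ l)"
      unfolding g_def[symmetric] by (simp add: inner_sum_left sum_distrib_left G[OF v] mult_ac)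
    also have "\<dots> = (\<Sum>i\<in>UNIV. \<Sum>j\<in>UNIV. (C \<bullet> partial j R v) * (g $ j $ i * G v $ i $ l))"
      by (intro sum.cong refl) (use gs in simp)
    also have "\<dots> = (\<Sum>j\<in>UNIV. (C \<bullet> partial j R v) * (g ** G v) $ j $ l)"
      by (subst sum.swap) (simp add: matrix_matrix_mult_def sum_distrib_left)
    also have "\<dots> = (\<Sum>j\<in>UNIV. if j = l then C \<bullet> partial j R v else 0)"
      by (rule sum.cong) (auto simp: g_def matrix_inv_inverse[OF gram_invertible[OF v]] mat_def)
    also have "\<dots> = C \<bullet> partial l R v" by simp
    finally show "(?S - (1 / K) *\<^sub>R Q) \<bullet> partial l R v = 0"
      using Q(2)[of l] K by (simp add: inner_diff_left field_simps)
  qed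
  then show ?thesis by simp
qed

end

section \<open>The Lie algebra of the special unitary group\<close>

lemma matrix_mult_add_left: "(A + B) ** C = A ** C + B ** (C :: 'a::semiring_1^_^_)"
  by (simp add: matrix_matrix_mult_def vec_eq_iff distrib_right sum.distrib)

lemma matrix_mult_diff: "(A - B) ** C = A ** C - B ** C" "D ** (A - B) = D ** A - D ** (B :: 'a::ring_1^_^_)"
  by (simp_all add: matrix_matrix_mult_def vec_eq_iff left_diff_distrib right_diff_distrib sum_subtractf)

lemma matrix_mult_minus: "(- A) ** B = - (A ** B)" "A ** (- B) = - (A ** (B :: 'a::ring_1^_^_))"
  by (simp_all add: matrix_matrix_mult_def vec_eq_iff sum_negf)

lemma matrix_mult_scaleR:
  fixes A B :: "complex^_^_"
  shows "(c *\<^sub>R A) ** B = c *\<^sub>R (A ** B)" "A ** (c *\<^sub>R B) = c *\<^sub>R (A ** B)"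
  by (simp_all add: matrix_matrix_mult_def vec_eq_iff scaleR_sum_right)

lemma matrix_mult_sum:
  fixes A :: "complex^_^_"
  shows "A ** (\<Sum>i\<in>I. B i) = (\<Sum>i\<in>I. A ** B i)"
  by (induction I rule: infinite_finite_induct) (auto simp: matrix_add_ldistrib)

lemma bounded_bilinear_matrix_mult: "bounded_bilinear ((**) :: complex^'n^'m \<Rightarrow> complex^'p^'n \<Rightarrow> complex^'p^'m)"
  by (rule bilinear_conv_bounded_bilinear[THEN iffD1])
    (auto simp: bilinear_def matrix_mult_add_left matrix_add_ldistrib matrix_mult_scaleR intro!: linearI)

lemma herm_nth [simp]: "herm A $ i $ j = cnj (A $ j $ i)"
  by (simp add: herm_def)

lemma herm_herm [simp]: "herm (herm A) = A"
  by (simp add: vec_eq_iff)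

lemma herm_mult: "herm (A ** B) = herm B ** herm (A :: complex^'n^'n)"
  by (simp add: vec_eq_iff matrix_matrix_mult_def mult.commute)

lemma herm_add: "herm (A + B) = herm A + herm B" and herm_diff: "herm (A - B) = herm A - herm B"
  and herm_scaleR: "herm (c *\<^sub>R A) = c *\<^sub>R herm A"
  by (simp_all add: vec_eq_iff)

lemma herm_mat [simp]: "herm (mat 1) = mat 1"
  by (simp add: vec_eq_iff mat_def)

lemma bounded_linear_herm: "bounded_linear (herm :: complex^'n^'n \<Rightarrow> complex^'n^'n)"
  by (rule linear_conv_bounded_linear[THEN iffD1], rule linearI) (simp_all add: herm_add herm_scaleR)

lemma bounded_linear_transpose: "bounded_linear (transpose :: complex^'n^'n \<Rightarrow> complex^'n^'n)"
  by (rule linear_conv_bounded_linear[THEN iffD1], rule linearI) (simp_all add: transpose_def vec_eq_iff)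

lemma trace_scaleR: "trace (c *\<^sub>R A) = c *\<^sub>R trace (A :: complex^'n^'n)"
  by (simp add: trace_def scaleR_sum_right)

lemma trace_minus: "trace (- A) = - trace (A :: complex^'n^'n)"
  by (simp add: trace_def sum_negf)

lemma bounded_linear_trace: "bounded_linear (trace :: complex^'n^'n \<Rightarrow> complex)"
  by (rule linear_conv_bounded_linear[THEN iffD1], rule linearI) (simp_all add: trace_add trace_scaleR)

lemma trace_herm: "trace (herm A) = cnj (trace A)"
  by (simp add: trace_def)

lemma inner_eq_Re_trace: "A \<bullet> B = Re (trace (A ** herm B))"
  for A B :: "complex^'n^'n"
  by (simp add: trace_def matrix_matrix_mult_def inner_vec_def inner_complex_def)

lemma SU_herm:
  assumes "x \<in> SU"
  shows "x ** herm x = mat 1" "herm x ** x = mat 1" "det x = 1"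
  using assms matrix_left_right_inverse[of x "herm x"] by (auto simp: SU_def)

lemma unitary_inner:
  fixes x A B :: "complex^'n^'n"
  assumes "herm x ** x = mat 1"
  shows "(x ** A) \<bullet> (x ** B) = A \<bullet> B"
proof -
  have "trace ((x ** A) ** herm (x ** B)) = trace (x ** (A ** herm B ** herm x))"
    by (simp add: herm_mult matrix_mul_assoc)
  also have "\<dots> = trace ((A ** herm B ** herm x) ** x)" by (rule trace_mul_sym)
  also have "\<dots> = trace (A ** herm B)"
    by (simp add: matrix_mul_assoc[symmetric] assms)
  finally show ?thesis by (simp add: inner_eq_Re_trace)
qed

section \<open>The Lie algebra su(n) and the orthogonal projection onto it\<close>

definition su_alg :: "(complex^'n^'n) set"
  where "su_alg = {X. herm X = - X \<and> trace X = 0}"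

lemma subspace_su_alg: "subspace su_alg"
  by (auto simp: subspace_def su_alg_def herm_add trace_add herm_scaleR trace_scaleR)
    (simp_all add: vec_eq_iff trace_def)

text \<open>A permutation other than the identity moves at least two points, so after one factor has
  been differentiated its product still contains an off-diagonal zero of the identity
  matrix.\<close>

lemma det_has_derivative: "(det has_derivative trace) (at (mat 1 :: complex^'n^'n))"
proof -
  let ?P = "{p. p permutes (UNIV :: 'n set)}"
  let ?D = "\<lambda>X::complex^'n^'n. \<Sum>p\<in>?P. of_int (sign p) * (\<Sum>i\<in>UNIV. X $ i $ p i * (\<Prod>j\<in>UNIV-{i}. mat 1 $ j $ p j))"
  have "((\<lambda>A. \<Sum>p\<in>?P. of_int (sign p) * (\<Prod>i\<in>UNIV. A $ i $ p i)) has_derivative ?D) (at (mat 1 :: complex^'n^'n))"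
    by (intro has_derivative_sum has_derivative_mult_right has_derivative_prod bounded_linear_imp_has_derivative
        bounded_linear_compose[OF bounded_linear_vec_nth bounded_linear_vec_nth])
  moreover have "?D X = trace X" for X
  proof -
    have "(\<Sum>i\<in>UNIV. X $ i $ p i * (\<Prod>j\<in>UNIV-{i}. mat 1 $ j $ p j)) = 0" if p: "p permutes UNIV" "p \<noteq> id" for p
    proof (intro sum.neutral ballI)
      fix i
      obtain j where j: "p j \<noteq> j" using p(2) by (auto simp: fun_eq_iff)
      \<comment> \<open>If the moved point found above is i itself, then \<open>p i\<close> is a
        second moved point by injectivity.\<close>
      have "\<exists>j. j \<noteq> i \<and> p j \<noteq> j"
        using j permutes_inj[OF p(1)] by (metis injD)
      then have "(\<Prod>j\<in>UNIV-{i}. mat 1 $ j $ p j :: complex) = 0"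
        by (force intro: prod_zero simp: mat_def)
      then show "X $ i $ p i * (\<Prod>j\<in>UNIV-{i}. mat 1 $ j $ p j) = 0" by simp
    qed
    then have "?D X = (\<Sum>p\<in>?P. if p = id then of_int (sign p) * (\<Sum>i\<in>UNIV. X $ i $ p i * (\<Prod>j\<in>UNIV-{i}. mat 1 $ j $ p j)) else 0)"
      by (intro sum.cong) auto
    also have "\<dots> = (\<Sum>i\<in>UNIV. X $ i $ i * (\<Prod>j\<in>UNIV-{i}. mat 1 $ j $ j))"
      by (simp add: permutes_id)
    finally show ?thesis by (simp add: mat_def trace_def)
  qed
  ultimately show ?thesis
    by (simp add: det_def[abs_def] fun_eq_iff)
qed

text \<open>Skewness comes from differentiating the constant \<open>herm (r y) ** r y\<close>. For
  the trace the factor \<open>herm (r v)\<close> is frozen: the product is the identity at v, where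
  \<open>det\<close> has derivative \<open>trace\<close>, and its determinant is 1 on all of
  V.\<close>

lemma left_derivative_in_su_alg:
  fixes r :: "real^'d \<Rightarrow> complex^'n^'n"
  assumes "open V" "v \<in> V" "r ` V \<subseteq> SU" "r differentiable (at v)"
  shows "left_derivative r v w \<in> su_alg"
proof -
  let ?D = "frechet_derivative r (at v)"
  have D: "(r has_derivative ?D) (at v)" using assms(4) frechet_derivative_works by blast
  have SU: "r y \<in> SU" if "y \<in> V" for y using assms(3) that by auto
  note bl = bounded_bilinear_matrix_mult bounded_linear_herm
  have "((\<lambda>y. herm (r y) ** r y) has_derivative (\<lambda>w. herm (r v) ** ?D w + herm (?D w) ** r v)) (at v)"
    by (rule bounded_bilinear.FDERIV[OF bl(1) bounded_linear.has_derivative[OF bl(2) D] D])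
  then have "((\<lambda>y. mat 1) has_derivative (\<lambda>w. herm (r v) ** ?D w + herm (?D w) ** r v)) (at v)"
    by (rule has_derivative_transform_within_open[OF _ assms(1,2)]) (simp add: SU_herm(2)[OF SU])
  from has_derivative_unique[OF this has_derivative_const]
  have "herm (r v) ** ?D w + herm (?D w) ** r v = 0" by (rule fun_cong)
  moreover have "trace (herm (r v) ** ?D w) = 0"
  proof -
    have "((\<lambda>y. herm (r v) ** r y) has_derivative (\<lambda>w. herm (r v) ** ?D w)) (at v)"
      by (rule bounded_linear.has_derivative[OF bounded_bilinear.bounded_linear_right[OF bl(1)] D])
    moreover have "(det has_derivative trace) (at (herm (r v) ** r v))"
      using det_has_derivative by (simp add: SU_herm(2)[OF SU[OF assms(2)]])
    ultimately have d: "((\<lambda>y. det (herm (r v) ** r y)) has_derivative (\<lambda>w. trace (herm (r v) ** ?D w))) (at v)"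
      by (rule has_derivative_compose)
    have dt: "det (herm (r v)) = 1"
    proof -
      have "det (r v ** herm (r v)) = 1" using SU_herm(1)[OF SU[OF assms(2)]] by simp
      then show ?thesis using SU_herm(3)[OF SU[OF assms(2)]] by (simp add: det_mul)
    qed
    have "((\<lambda>y. 1) has_derivative (\<lambda>w. trace (herm (r v) ** ?D w))) (at v)"
      by (rule has_derivative_transform_within_open[OF d assms(1,2)]) (simp add: SU_herm(3)[OF SU] det_mul dt)
    from has_derivative_unique[OF this has_derivative_const]
    show ?thesis by (rule fun_cong)
  qed
  ultimately show ?thesis
    by (simp add: left_derivative_def su_alg_def herm_mult eq_neg_iff_add_eq_0 add.commute)
qed

text \<open>The orthogonal projection onto \<open>su_alg\<close>: the skew-Hermitian part of Y has
  trace i Im (trace Y), which the scalar matrix removes.\<close>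

definition su_part :: "complex^'n^'n \<Rightarrow> complex^'n^'n"
  where "su_part Y = (1/2) *\<^sub>R (Y - herm Y) - mat (\<i> * of_real (Im (trace Y)) / of_nat CARD('n))"

lemma trace_mat_scalar: "trace (mat z :: complex^'n^'n) = of_nat CARD('n) * z"
  by (simp add: trace_def mat_def)

lemma su_part_in_su_alg:
  fixes Y :: "complex^'n^'n"
  shows "su_part Y \<in> su_alg"
proof -
  have "herm (mat (\<i> * of_real r / of_nat n)) = - (mat (\<i> * of_real r / of_nat n) :: complex^'n^'n)" for r n
    by (simp add: vec_eq_iff mat_def)
  then have "herm (su_part Y) = - su_part Y"
    by (simp add: su_part_def herm_diff herm_scaleR scaleR_diff_right)
  moreover have "trace (su_part Y) = 0"
    by (simp add: su_part_def trace_sub trace_scaleR trace_herm trace_mat_scalar complex_eq_iff)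
  ultimately show ?thesis by (simp add: su_alg_def)
qed

lemma hermitian_inner_su_alg:
  fixes H X :: "complex^'n^'n"
  assumes "herm H = H" "X \<in> su_alg"
  shows "H \<bullet> X = 0"
proof -
  have "trace (H ** herm X) = - trace (H ** X)"
    using assms by (simp add: su_alg_def matrix_mult_minus trace_minus)
  moreover have "cnj (trace (H ** herm X)) = trace (H ** X)"
    using assms(1) trace_mul_sym[of X H] by (simp add: trace_herm[symmetric] herm_mult)
  ultimately have "cnj (trace (H ** herm X)) = - trace (H ** herm X)" by simp
  then have "Re (cnj (trace (H ** herm X))) = Re (- trace (H ** herm X))" by (rule arg_cong)
  then show ?thesis by (simp add: inner_eq_Re_trace)
qed

text \<open>The remainder is a Hermitian matrix plus an imaginary multiple of the identity. The
  former is orthogonal to skew-Hermitian matrices, the latter to traceless ones.\<close>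

lemma su_part_orthogonal:
  fixes X Y :: "complex^'n^'n"
  assumes "X \<in> su_alg"
  shows "(Y - su_part Y) \<bullet> X = 0"
proof -
  define z where "z = Im (trace Y) / real CARD('n)"
  have Y: "Y - su_part Y = (1/2) *\<^sub>R (Y + herm Y) + mat (\<i> * of_real z)"
    by (simp add: su_part_def vec_eq_iff algebra_simps complex_eq_iff z_def)
  have "((1/2) *\<^sub>R (Y + herm Y)) \<bullet> X = 0"
    by (rule hermitian_inner_su_alg[OF _ assms]) (simp add: herm_scaleR herm_add add.commute)
  moreover have "mat (\<i> * of_real z) \<bullet> X = 0"
  proof -
    have "trace (mat (\<i> * of_real z) ** herm X) = (\<i> * of_real z) * trace (herm X)"
      by (simp add: trace_def mat_def matrix_matrix_mult_def if_distribR if_distrib[of "(*)"] sum_distrib_left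
          cong: if_cong)
    also have "\<dots> = 0" using assms by (simp add: su_alg_def trace_minus)
    finally show ?thesis by (simp add: inner_eq_Re_trace)
  qed
  ultimately show ?thesis unfolding Y by (simp add: inner_add_left)
qed

section \<open>Isometric immersions into the special unitary group\<close>

lemma mat_mult_commute: "mat z ** A = A ** mat z" for A :: "complex^'n^'n"
  by (simp add: mat_def matrix_matrix_mult_def vec_eq_iff if_distribR if_distrib[of "(*)"]
      if_distrib[of "\<lambda>x. _ * x"] mult.commute cong: if_cong)

lemma bounded_linear_entry: "bounded_linear (\<lambda>Z::complex^'n^'n. Z $ a $ b)"
  by (intro bounded_linear_compose[OF bounded_linear_vec_nth bounded_linear_vec_nth])

lemma transpose_linear:
  fixes A B :: "complex^'n^'n"
  shows "transpose (A + B) = transpose A + transpose B" "transpose (A - B) = transpose A - transpose B"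
    "transpose (c *\<^sub>R A) = c *\<^sub>R transpose A"
  by (simp_all add: transpose_def vec_eq_iff)

lemma transpose_herm: "transpose (herm A) = herm (transpose A)"
  by (simp add: transpose_def vec_eq_iff)

text \<open>
  The map \<open>L\<close> is the identity for charts of the group itself, and the transposition for the Cartan
  embedding \<open>x SO(n) \<mapsto> x x\<^sup>t\<close> of the quotient, whose image consists of symmetric matrices.
\<close>

locale SU_immersion = isometric_immersion V R K G
  for V :: "(real^'d) set" and R :: "real^'d \<Rightarrow> complex^'n^'n" and K :: real and G +
  fixes L :: "complex^'n^'n \<Rightarrow> complex^'n^'n"
  assumes L: "L = (\<lambda>A. A) \<or> L = transpose"
    and SU: "v \<in> V \<Longrightarrow> R v \<in> SU"
    and L_R: "v \<in> V \<Longrightarrow> L (R v) = R v"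
    and tangent: "v \<in> V \<Longrightarrow> L A = A \<Longrightarrow> herm (R v) ** A \<in> su_alg
      \<Longrightarrow> A \<in> range (frechet_derivative R (at v))"
begin

lemma linear_L: "bounded_linear L"
  using L bounded_linear_transpose bounded_linear_ident by auto

lemma L_partial:
  assumes "v \<in> V"
  shows "L (partial i R v) = partial i R v"
proof -
  have "L (partial i R v) = partial i (\<lambda>y. L (R y)) v"
    by (rule partial_linear[OF linear_L differentiable(1)[OF assms], symmetric])
  also have "\<dots> = partial i R v" by (rule partial_cong[OF V assms L_R])
  finally show ?thesis .
qed

lemma L_covhess: "v \<in> V \<Longrightarrow> L (covhess G i j R v) = covhess G i j R v"
proof -
  assume v: "v \<in> V"
  have "covhess G i j (\<lambda>y. L (R y)) v = covhess G i j R v"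
    unfolding covhess_def using partial_partial_cong[OF V v L_R] partial_cong[OF V v L_R] by simp
  then show ?thesis using covhess_linear[OF V v linear_L C2] by simp
qed

text \<open>The sum is symmetrised in A and B because transposition interchanges the two
  products.\<close>

lemma L_sandwich:
  assumes "v \<in> V" "L A = A" "L B = B"
  shows "L (A ** herm (R v) ** B + B ** herm (R v) ** A) = A ** herm (R v) ** B + B ** herm (R v) ** A"
  using L
proof
  assume "L = transpose"
  then show ?thesis using assms L_R[OF assms(1)]
    by (simp add: transpose_linear matrix_transpose_mul transpose_herm matrix_mul_assoc add.commute)
qed simp

lemma partial_eq_left: "v \<in> V \<Longrightarrow> R v ** left_derivative R v (axis i 1) = partial i R v"
  by (simp add: left_derivative_def matrix_mul_assoc SU_herm[OF SU] partial_def)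

lemma left_in_su: "v \<in> V \<Longrightarrow> left_derivative R v w \<in> su_alg"
  using left_derivative_in_su_alg[OF V _ _ differentiable(1)] SU by blast

text \<open>The tangent space at \<open>R v\<close> consists of the L-fixed A with
  \<open>herm (R v) ** A\<close> in \<open>su_alg\<close>. Projecting therefore means translating to
  the identity, applying \<open>su_part\<close> and translating back; the result stays L-fixed
  because C is.\<close>

lemma projection:
  assumes v: "v \<in> V" and C: "L C = C"
  shows "(\<Sum>i\<in>UNIV. \<Sum>j\<in>UNIV. (matrix_inv (G v) $ i $ j * (C \<bullet> partial j R v)) *\<^sub>R partial i R v)
    = (1 / K) *\<^sub>R (R v ** su_part (herm (R v) ** C))"
proof (rule gram_inv_projection[OF v])
  let ?Y = "herm (R v) ** C"
  note SUv = SU_herm[OF SU[OF v]]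
  have RY: "R v ** ?Y = C" using SUv(1) by (metis matrix_mul_assoc matrix_mul_lid)
  have "L (R v ** su_part ?Y) = R v ** su_part ?Y"
    using L
  proof
    assume t: "L = transpose"
    then have tr: "transpose (R v) = R v" "transpose C = C" using L_R[OF v] C by simp_all
    have "R v ** su_part ?Y = (1/2) *\<^sub>R (C - R v ** herm C ** R v)
        - R v ** mat (\<i> * of_real (Im (trace ?Y)) / of_nat CARD('n))"
      by (simp add: su_part_def matrix_mult_diff matrix_mult_scaleR herm_mult matrix_mul_assoc SUv)
    then show ?thesis
      by (simp add: t transpose_linear matrix_transpose_mul tr transpose_herm matrix_mul_assoc mat_mult_commute)
  qed simp
  then show "R v ** su_part ?Y \<in> range (frechet_derivative R (at v))"
    by (rule tangent[OF v]) (simp add: matrix_mul_assoc SUv su_part_in_su_alg)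
  show "(C - R v ** su_part ?Y) \<bullet> partial l R v = 0" for l
  proof -
    have "(C - R v ** su_part ?Y) \<bullet> partial l R v
        = (R v ** (?Y - su_part ?Y)) \<bullet> (R v ** left_derivative R v (axis l 1))"
      by (simp only: matrix_mult_diff RY partial_eq_left[OF v])
    also have "\<dots> = (?Y - su_part ?Y) \<bullet> left_derivative R v (axis l 1)"
      by (rule unitary_inner[OF SUv(2)])
    also have "\<dots> = 0" by (rule su_part_orthogonal[OF left_in_su[OF v]])
    finally show ?thesis .
  qed
qed

text \<open>A complex linear functional of R is a pair of real ones, the inner products with C and i
  C, where C is the entrywise conjugate of M. Each is contracted by \<open>projection\<close>, for
  which M has to be L-fixed.\<close>

lemma Kap_trace:
  assumes v: "v \<in> V" and M: "L M = M"
  shows "Kap G (\<lambda>y. trace (transpose M ** R y)) (\<lambda>y. R y $ a $ b) v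
    = - (1 / of_real K) * ((R v ** transpose M ** R v) $ a $ b
        - trace (transpose M ** R v) / of_nat CARD('n) * R v $ a $ b)"
proof -
  define C where "C = herm (transpose M)"
  define Ci where "Ci = (\<chi> i j. \<i> * C $ i $ j)"
  define S where "S = (\<lambda>C. \<Sum>i\<in>UNIV. \<Sum>j\<in>UNIV. (matrix_inv (G v) $ i $ j * (C \<bullet> partial j R v)) *\<^sub>R partial i R v)"
  note SUv = SU_herm[OF SU[OF v]]
  have LC: "L C = C" "L Ci = Ci"
    using L M by (auto simp: C_def Ci_def transpose_def vec_eq_iff)
  have tr: "trace (transpose M ** Z) = of_real (C \<bullet> Z) + \<i> * of_real (Ci \<bullet> Z)" for Z
  proof -
    have "trace (transpose M ** Z) = (\<Sum>i\<in>UNIV. \<Sum>j\<in>UNIV. M $ j $ i * Z $ j $ i)"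
      by (simp add: trace_def matrix_matrix_mult_def transpose_def)
    also have "\<dots> = (\<Sum>j\<in>UNIV. \<Sum>i\<in>UNIV. of_real (C $ j $ i \<bullet> Z $ j $ i) + \<i> * of_real (Ci $ j $ i \<bullet> Z $ j $ i))"
      by (subst sum.swap, intro sum.cong refl)
        (simp add: C_def Ci_def inner_complex_def complex_eq_iff transpose_def)
    finally show ?thesis
      by (simp add: inner_vec_def sum.distrib sum_distrib_left)
  qed
  have "Kap G (\<lambda>y. trace (transpose M ** R y)) (\<lambda>y. R y $ a $ b) v
     = (\<Sum>i\<in>UNIV. \<Sum>j\<in>UNIV. matrix_inv (G v) $ i $ j *\<^sub>R (trace (transpose M ** partial i R v) * partial j R v $ a $ b))"
    unfolding Kap_def
    by (simp only: partial_linear[OF bounded_linear_entry differentiable(1)[OF v]]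
        partial_linear[OF bounded_linear_compose[OF bounded_linear_trace
            bounded_bilinear.bounded_linear_right[OF bounded_bilinear_matrix_mult]] differentiable(1)[OF v]])
  also have "\<dots> = (\<Sum>j\<in>UNIV. \<Sum>i\<in>UNIV. matrix_inv (G v) $ j $ i *\<^sub>R (trace (transpose M ** partial i R v) * partial j R v $ a $ b))"
    by (subst sum.swap) (simp add: gram_inv_sym[OF v])
  also have "\<dots> = S C $ a $ b + \<i> * S Ci $ a $ b"
    unfolding S_def tr
    by (simp add: sum_distrib_left sum.distrib[symmetric] scaleR_conv_of_real[where 'a=complex] algebra_simps)
  also have "\<dots> = of_real (1 / K) * (R v ** (\<chi> p q. su_part (herm (R v) ** C) $ p $ q + \<i> * su_part (herm (R v) ** Ci) $ p $ q)) $ a $ b"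
    unfolding S_def projection[OF v LC(1)] projection[OF v LC(2)]
    by (simp add: matrix_matrix_mult_def scaleR_conv_of_real[where 'a=complex] sum_distrib_left sum.distrib algebra_simps)
  \<comment> \<open>In \<open>su_part\<close> of Y plus i times \<open>su_part\<close> of i Y,
    whatever is complex linear in Y cancels and the antilinear part doubles: -\<open>herm Y\<close>
    plus the conjugate of trace Y divided by n.\<close>
  also have "(\<chi> p q. su_part (herm (R v) ** C) $ p $ q + \<i> * su_part (herm (R v) ** Ci) $ p $ q)
     = mat (trace (transpose M ** R v) / of_nat CARD('n)) - transpose M ** R v"
  proof -
    define Y where "Y = herm (R v) ** C"
    have Yi: "herm (R v) ** Ci = (\<chi> p q. \<i> * Y $ p $ q)"
      by (simp add: Y_def Ci_def matrix_matrix_mult_def sum_distrib_left mult_ac)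
    have MY: "transpose M ** R v = herm Y" by (simp add: Y_def C_def herm_mult)
    have tY: "trace (\<chi> p q. \<i> * Y $ p $ q) = \<i> * trace Y"
      by (simp add: trace_def sum_distrib_left)
    show ?thesis
      unfolding Yi MY Y_def[symmetric]
      by (simp add: vec_eq_iff su_part_def tY trace_herm mat_def complex_eq_iff field_simps)
  qed
  finally show ?thesis
    by (simp add: matrix_mult_diff mat_mult_commute[symmetric] matrix_mul_assoc)
      (simp add: matrix_matrix_mult_def mat_def if_distribR if_distrib[of "(*)"] algebra_simps
        diff_divide_distrib cong: if_cong)
qed

text \<open>With X_j = \<open>herm R ** partial j R\<close> in su(n), d_i d_j R = R (X_i X_j + d_i
  X_j). Averaging the two orders leaves half the anticommutator of X_i and X_j, which is the
  subtracted term, and derivatives of su(n)-valued functions, which stay in su(n).\<close>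

lemma herm_partial_partial:
  assumes v: "v \<in> V"
  shows "herm (R v) ** partial i (partial j R) v
    - (1/2) *\<^sub>R (herm (R v) ** (partial i R v ** herm (R v) ** partial j R v + partial j R v ** herm (R v) ** partial i R v)) \<in> su_alg"
proof -
  define X where "X = (\<lambda>j y. herm (R y) ** partial j R y)"
  note SUv = SU_herm[OF SU[OF v]]
  have Xsu: "X j y \<in> su_alg" if "y \<in> V" for j y
    using left_in_su[OF that, of "axis j 1"] by (simp add: X_def left_derivative_def partial_def)
  have dX: "X j differentiable (at v)" for j
  proof -
    have "(\<lambda>y. herm (R y)) differentiable (at v)"
      by (rule differentiable_linear[OF bounded_linear_herm differentiable(1)[OF v]])
    then show ?thesis unfolding X_def 
      using bounded_bilinear.FDERIV[OF bounded_bilinear_matrix_mult] differentiable(2)[OF v]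
      unfolding differentiable_def by blast
  qed
  have pX: "partial i (X j) v \<in> su_alg" for i j
  proof -
    have "herm (partial i (X j) v) = partial i (\<lambda>y. herm (X j y)) v"
      by (rule partial_linear[OF bounded_linear_herm dX, symmetric])
    also have "\<dots> = partial i (\<lambda>y. - X j y) v"
      by (rule partial_cong[OF V v]) (use Xsu in \<open>auto simp: su_alg_def\<close>)
    also have "\<dots> = - partial i (X j) v"
      by (rule partial_linear[OF bounded_linear_minus[OF bounded_linear_ident] dX])
    finally have 1: "herm (partial i (X j) v) = - partial i (X j) v" .
    have "trace (partial i (X j) v) = partial i (\<lambda>y. trace (X j y)) v"
      by (rule partial_linear[OF bounded_linear_trace dX, symmetric])
    also have "\<dots> = partial i (\<lambda>y. 0) v"
      by (rule partial_cong[OF V v]) (use Xsu in \<open>auto simp: su_alg_def\<close>)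
    finally show ?thesis using 1 by (simp add: su_alg_def)
  qed
  have pp: "herm (R v) ** partial i (partial j R) v = X i v ** X j v + partial i (X j) v" for i j
  proof -
    have "partial i (partial j R) v = partial i (\<lambda>y. R y ** X j y) v"
      by (rule partial_cong[OF V v]) (simp add: X_def matrix_mul_assoc SU_herm[OF SU])
    also have "\<dots> = R v ** partial i (X j) v + partial i R v ** X j v"
      by (rule partial_bilinear[OF bounded_bilinear_matrix_mult differentiable(1)[OF v] dX])
    finally show ?thesis
      by (simp add: matrix_add_ldistrib matrix_mul_assoc SUv add.commute) (simp add: X_def matrix_mul_assoc)
  qed
  have c: "partial i (partial j R) v = partial j (partial i R) v"
    by (rule partial_commute[OF V v C2])
  have "herm (R v) ** partial i (partial j R) v
     = (1/2) *\<^sub>R (herm (R v) ** partial i (partial j R) v + herm (R v) ** partial j (partial i R) v)"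
    by (simp add: c scaleR_2[symmetric])
  also have "\<dots> = (1/2) *\<^sub>R (X i v ** X j v + X j v ** X i v) + (1/2) *\<^sub>R (partial i (X j) v + partial j (X i) v)"
    unfolding pp by (simp add: algebra_simps)
  also have "X i v ** X j v + X j v ** X i v
     = herm (R v) ** (partial i R v ** herm (R v) ** partial j R v + partial j R v ** herm (R v) ** partial i R v)"
    by (simp add: X_def matrix_add_ldistrib matrix_mul_assoc)
  finally show ?thesis
    using subspace_scale[OF subspace_su_alg subspace_add[OF subspace_su_alg pX pX]] by simp
qed

text \<open>
  Both sides are orthogonal to the image of the derivative, and their difference lies in it; this is
  why no second derivative of the parametrisation survives.
\<close>

lemma covhess_eq:
  assumes v: "v \<in> V"
  shows "covhess G i j R v
    = (1/2) *\<^sub>R (partial i R v ** herm (R v) ** partial j R v + partial j R v ** herm (R v) ** partial i R v)"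
    (is "_ = (1/2) *\<^sub>R ?S")
proof -
  note SUv = SU_herm[OF SU[OF v]]
  define N where "N = covhess G i j R v - (1/2) *\<^sub>R ?S"
  have "L N = N"
    using L_covhess[OF v] L_sandwich[OF v L_partial[OF v] L_partial[OF v]] linear_L
    by (simp add: N_def linear_diff linear_cmul bounded_linear.linear)
  moreover have "herm (R v) ** N \<in> su_alg"
  proof -
    have "herm (R v) ** N = (herm (R v) ** partial i (partial j R) v - (1/2) *\<^sub>R (herm (R v) ** ?S))
       - (\<Sum>m\<in>UNIV. christoffel G m i j v *\<^sub>R left_derivative R v (axis m 1))"
      by (simp add: N_def covhess_def matrix_mult_diff matrix_mult_scaleR matrix_mult_sum left_derivative_def partial_def)
    then show ?thesis
      by (simp only:) (intro subspace_diff[OF subspace_su_alg herm_partial_partial[OF v]]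
          subspace_sum[OF subspace_su_alg] subspace_scale[OF subspace_su_alg] left_in_su[OF v])
  qed
  ultimately have "N \<in> range (frechet_derivative R (at v))" by (rule tangent[OF v])
  moreover have "N \<bullet> partial l R v = 0" for l
  proof -
    have sk: "herm (left_derivative R v w) = - left_derivative R v w" for w
      using left_in_su[OF v] by (simp add: su_alg_def)
    let ?l = "\<lambda>i. left_derivative R v (axis i 1)"
    \<comment> \<open>Translated to the identity, \<open>?S\<close> is an anticommutator of
      skew-Hermitian matrices, hence Hermitian and orthogonal to su(n).\<close>
    have "?S = R v ** (?l i ** ?l j + ?l j ** ?l i)"
      unfolding partial_eq_left[OF v, symmetric] matrix_add_ldistrib
      by (metis (no_types) SUv(2) matrix_mul_assoc matrix_mul_rid)
    then have "?S \<bullet> partial l R v = (?l i ** ?l j + ?l j ** ?l i) \<bullet> ?l l"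
      using unitary_inner[OF SUv(2)] partial_eq_left[OF v, of l] by metis
    also have "\<dots> = 0"
      by (rule hermitian_inner_su_alg[OF _ left_in_su[OF v]])
        (simp add: herm_add herm_mult sk matrix_mult_minus add.commute)
    finally show ?thesis by (simp add: N_def inner_diff_left covhess_normal[OF v])
  qed
  ultimately have "N = 0" by (rule eq_zero_if_orthogonal_to_range[OF v])
  then show ?thesis by (simp add: N_def)
qed

text \<open>Contraction with the symmetric inverse metric identifies the two orders of the sandwich
  product, which absorbs the factor 1/2. This reduces tau on entries to kappa on entries.\<close>

lemma Lap_entry:
  assumes v: "v \<in> V"
  shows "Lap G (\<lambda>y. R y $ a $ b) v
    = (\<Sum>q\<in>UNIV. \<Sum>p\<in>UNIV. cnj (R v $ q $ p) * Kap G (\<lambda>y. R y $ a $ p) (\<lambda>y. R y $ q $ b) v)"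
proof -
  let ?T = "\<lambda>i j. partial i R v ** herm (R v) ** partial j R v"
  let ?g = "matrix_inv (G v)"
  have e: "(\<Sum>i\<in>UNIV. \<Sum>j\<in>UNIV. ?g $ i $ j *\<^sub>R ?T j i) = (\<Sum>i\<in>UNIV. \<Sum>j\<in>UNIV. ?g $ i $ j *\<^sub>R ?T i j)"
    by (subst sum.swap) (simp add: gram_inv_sym[OF v])
  have "Lap G R v = (1/2) *\<^sub>R ((\<Sum>i\<in>UNIV. \<Sum>j\<in>UNIV. ?g $ i $ j *\<^sub>R ?T i j)
      + (\<Sum>i\<in>UNIV. \<Sum>j\<in>UNIV. ?g $ i $ j *\<^sub>R ?T j i))"
    by (simp add: Lap_def covhess_eq[OF v] scaleR_right_distrib sum.distrib scaleR_sum_right)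
  also have "\<dots> = (\<Sum>i\<in>UNIV. \<Sum>j\<in>UNIV. ?g $ i $ j *\<^sub>R ?T i j)"
    unfolding e by (simp flip: scaleR_2)
  finally have "Lap G R v = (\<Sum>i\<in>UNIV. \<Sum>j\<in>UNIV. ?g $ i $ j *\<^sub>R ?T i j)" .
  moreover have "Lap G (\<lambda>y. R y $ a $ b) v = Lap G R v $ a $ b"
    by (rule Lap_linear[OF V v bounded_linear_entry C2])
  moreover have "?T i j $ a $ b = (\<Sum>q\<in>UNIV. \<Sum>p\<in>UNIV. cnj (R v $ q $ p) * (partial i R v $ a $ p * partial j R v $ q $ b))" for i j
    by (simp add: matrix_matrix_mult_def sum_distrib_right sum_distrib_left mult_ac)
  ultimately have "Lap G (\<lambda>y. R y $ a $ b) v = (\<Sum>i\<in>UNIV. \<Sum>j\<in>UNIV. \<Sum>q\<in>UNIV. \<Sum>p\<in>UNIV. 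
      ?g $ i $ j *\<^sub>R (cnj (R v $ q $ p) * (partial i R v $ a $ p * partial j R v $ q $ b)))"
    by (simp add: scaleR_sum_right)
  also have "\<dots> = (\<Sum>x\<in>UNIV\<times>UNIV. \<Sum>y\<in>UNIV\<times>UNIV.
      ?g $ fst x $ snd x *\<^sub>R (cnj (R v $ fst y $ snd y) * (partial (fst x) R v $ a $ snd y * partial (snd x) R v $ fst y $ b)))"
    by (simp only: sum.cartesian_product' fst_conv snd_conv)
  also have "\<dots> = (\<Sum>y\<in>UNIV\<times>UNIV. \<Sum>x\<in>UNIV\<times>UNIV.
      ?g $ fst x $ snd x *\<^sub>R (cnj (R v $ fst y $ snd y) * (partial (fst x) R v $ a $ snd y * partial (snd x) R v $ fst y $ b)))"
    by (rule sum.swap)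
  also have "\<dots> = (\<Sum>q\<in>UNIV. \<Sum>p\<in>UNIV. cnj (R v $ q $ p) * Kap G (\<lambda>y. R y $ a $ p) (\<lambda>y. R y $ q $ b) v)"
    by (simp only: sum.cartesian_product' fst_conv snd_conv Kap_def partial_linear[OF bounded_linear_entry differentiable(1)[OF v]]
        sum_distrib_left mult_scaleR_right)
  finally show ?thesis .
qed

end

section \<open>The operators on the entries of \<open>\<Phi>\<close>\<close>

definition matrix_unit :: "'n \<Rightarrow> 'n \<Rightarrow> complex^'n^'n"
  where "matrix_unit a b = (\<chi> p q. if p = a \<and> q = b then 1 else 0)"

lemma transpose_matrix_unit: "transpose (matrix_unit a b) = matrix_unit b a"
  by (auto simp: matrix_unit_def transpose_def vec_eq_iff)

lemma mult_matrix_unit: "(Z ** matrix_unit b a) $ p $ q = (if q = a then Z $ p $ b else 0)"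
  for Z :: "complex^'n^'n"
proof -
  have "(Z ** matrix_unit b a) $ p $ q = (\<Sum>k\<in>UNIV. if k = b then (if q = a then Z $ p $ b else 0) else 0)"
    by (simp only: matrix_matrix_mult_def matrix_unit_def vec_lambda_beta, rule sum.cong) auto
  then show ?thesis by simp
qed

lemma sandwich_matrix_unit: "(Z ** matrix_unit b a ** Z) $ c $ d = Z $ c $ b * Z $ a $ d"
  for Z :: "complex^'n^'n"
proof -
  have "(Z ** matrix_unit b a ** Z) $ c $ d = (\<Sum>k\<in>UNIV. (Z ** matrix_unit b a) $ c $ k * Z $ k $ d)"
    by (simp add: matrix_matrix_mult_def)
  also have "\<dots> = (\<Sum>k\<in>UNIV. if k = a then Z $ c $ b * Z $ a $ d else 0)"
    by (rule sum.cong) (auto simp: mult_matrix_unit)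
  finally show ?thesis by simp
qed

lemma trace_matrix_unit: "trace (matrix_unit b a ** Z) = Z $ a $ b"
  for Z :: "complex^'n^'n"
  by (subst trace_mul_sym) (simp add: trace_def mult_matrix_unit)

text \<open>These contractions arise when kappa is inserted into \<open>Lap_entry\<close>; they are
  \<open>trace (x ** herm x)\<close>, \<open>x ** herm x ** x\<close> and
  \<open>transpose (herm x ** x) ** x\<close>.\<close>

lemma SU_sums:
  fixes x :: "complex^'n^'n"
  assumes "x \<in> SU"
  shows "(\<Sum>q\<in>UNIV. \<Sum>p\<in>UNIV. cnj (x $ q $ p) * x $ q $ p) = of_nat CARD('n)"
    and "(\<Sum>q\<in>UNIV. \<Sum>p\<in>UNIV. cnj (x $ q $ p) * (x $ a $ p * x $ q $ b)) = x $ a $ b"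
    and "(\<Sum>q\<in>UNIV. \<Sum>p\<in>UNIV. cnj (x $ q $ p) * (x $ q $ a * x $ p $ b)) = x $ a $ b"
proof -
  note x = SU_herm[OF assms]
  have "(\<Sum>q\<in>UNIV. \<Sum>p\<in>UNIV. cnj (x $ q $ p) * x $ q $ p) = trace (x ** herm x)"
    by (simp add: trace_def matrix_matrix_mult_def mult.commute)
  then show "(\<Sum>q\<in>UNIV. \<Sum>p\<in>UNIV. cnj (x $ q $ p) * x $ q $ p) = of_nat CARD('n)"
    by (simp add: x trace_I)
  have "(\<Sum>q\<in>UNIV. \<Sum>p\<in>UNIV. cnj (x $ q $ p) * (x $ a $ p * x $ q $ b)) = (x ** herm x ** x) $ a $ b"
    by (simp add: matrix_matrix_mult_def sum_distrib_right sum_distrib_left mult_ac)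
  then show "(\<Sum>q\<in>UNIV. \<Sum>p\<in>UNIV. cnj (x $ q $ p) * (x $ a $ p * x $ q $ b)) = x $ a $ b"
    by (simp add: x)
  have "(\<Sum>q\<in>UNIV. \<Sum>p\<in>UNIV. cnj (x $ q $ p) * (x $ q $ a * x $ p $ b))
      = (transpose (herm x ** x) ** x) $ a $ b"
    by (subst sum.swap) (simp add: matrix_matrix_mult_def transpose_def sum_distrib_right sum_distrib_left mult_ac)
  then show "(\<Sum>q\<in>UNIV. \<Sum>p\<in>UNIV. cnj (x $ q $ p) * (x $ q $ a * x $ p $ b)) = x $ a $ b"
    by (simp add: x)
qed

lemma Kap_sum_left:
  fixes f :: "'i \<Rightarrow> real^'d \<Rightarrow> complex"
  assumes "\<And>i. f i differentiable (at x)"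
  shows "Kap G (\<lambda>y. \<Sum>i\<in>I. f i y) h x = (\<Sum>i\<in>I. Kap G (f i) h x)"
proof (induction I rule: infinite_finite_induct)
  case (insert i I)
  have "(\<lambda>y. \<Sum>i\<in>I. f i y) differentiable (at x)"
    using insert(1) assms by (intro differentiable_sum) auto
  then have "partial j (\<lambda>y. f i y + (\<Sum>i\<in>I. f i y)) x = partial j (f i) x + partial j (\<lambda>y. \<Sum>i\<in>I. f i y) x" for j
    by (rule partial_add[OF assms])
  then show ?case using insert
    by (simp add: Kap_def distrib_right scaleR_right_distrib sum.distrib)
qed (simp_all add: Kap_def)

text \<open>
  The coefficient \<open>2/c\<close> comes out the same on the group and on the quotient, as it must for a
  Riemannian submersion with minimal fibres.
\<close>

definition Phi_like :: "real \<Rightarrow> (real^'d \<Rightarrow> real^'d^'d) \<Rightarrow> (real^'d) set \<Rightarrow> (real^'d \<Rightarrow> complex^'n^'n) \<Rightarrow> bool"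
  where "Phi_like c G V P \<longleftrightarrow> Ck_on 2 V P \<and> (\<forall>v\<in>V.
    transpose (P v) = P v \<and>
    (\<forall>i j. matrix_inv (G v) $ i $ j = matrix_inv (G v) $ j $ i) \<and>
    (\<forall>a b. Lap G (\<lambda>y. P y $ a $ b) v
      = - (2 / of_real c) * (of_nat CARD('n) + 1 - 2 / of_nat CARD('n)) * P v $ a $ b) \<and>
    (\<forall>a b c' d. Kap G (\<lambda>y. P y $ a $ b) (\<lambda>y. P y $ c' $ d) v
      = - (2 / of_real c) * (P v $ a $ d * P v $ b $ c' + P v $ a $ c' * P v $ b $ d
          - 2 / of_nat CARD('n) * (P v $ a $ b * P v $ c' $ d))))"

context SU_immersion
begin

text \<open>Symmetrising the matrix units contributes a factor 1/2, which turns 1/K into 2/(4 K);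
  hence the parameter \<open>4 * K\<close>.\<close>

lemma Phi_like_symmetric:
  assumes "L = transpose"
  shows "Phi_like (4 * K) G V R"
proof -
  let ?n = "of_nat CARD('n) :: complex"
  have sym: "R v $ a $ b = R v $ b $ a" if "v \<in> V" for v a b
  proof -
    have "transpose (R v) $ a $ b = R v $ a $ b" using L_R[OF that] assms by simp
    then show ?thesis by (simp add: transpose_def)
  qed
  have Kp: "Kap G (\<lambda>y. R y $ a $ b) (\<lambda>y. R y $ p $ q) v
      = - (1 / of_real K) * ((R v $ p $ b * R v $ a $ q + R v $ p $ a * R v $ b $ q) / 2 - R v $ a $ b * R v $ p $ q / ?n)"
    if v: "v \<in> V" for v a b p q
  proof -
    \<comment> \<open>A single matrix unit is in general not symmetric and so not L-fixed; its
      symmetrisation has the same trace pairing with symmetric matrices.\<close>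
    let ?M = "(1/2) *\<^sub>R (matrix_unit a b + matrix_unit b a)"
    have LM: "L ?M = ?M" and tM: "transpose ?M = ?M"
      by (simp_all add: assms transpose_linear transpose_matrix_unit add.commute)
    have tr: "trace (?M ** Z) = (Z $ a $ b + Z $ b $ a) / 2" for Z
      by (simp add: matrix_mult_scaleR matrix_mult_add_left trace_scaleR trace_add trace_matrix_unit
          scaleR_conv_of_real[where 'a=complex])
    have "Kap G (\<lambda>y. R y $ a $ b) (\<lambda>y. R y $ p $ q) v = Kap G (\<lambda>y. trace (transpose ?M ** R y)) (\<lambda>y. R y $ p $ q) v"
      unfolding tM by (rule Kap_cong[OF V v]) (simp only: tr, simp add: sym)
    also have "\<dots> = - (1 / of_real K) * ((R v ** ?M ** R v) $ p $ q
        - trace (?M ** R v) / of_nat CARD('n) * R v $ p $ q)"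
      using Kap_trace[OF v LM, of p q] unfolding tM .
    also have "(R v ** ?M ** R v) $ p $ q = (R v $ p $ b * R v $ a $ q + R v $ p $ a * R v $ b $ q) / 2"
      by (simp add: matrix_mult_scaleR matrix_mult_add_left matrix_add_ldistrib sandwich_matrix_unit
          scaleR_conv_of_real[where 'a=complex])
    finally show ?thesis unfolding tr using sym[OF v, of b a] by simp
  qed
  have Lp: "Lap G (\<lambda>y. R y $ a $ b) v = - (1 / of_real K) * ((?n + 1) / 2 - 1 / ?n) * R v $ a $ b"
    if v: "v \<in> V" for v a b
  proof -
    have "Lap G (\<lambda>y. R y $ a $ b) v = (\<Sum>q\<in>UNIV. \<Sum>p\<in>UNIV. - (1 / of_real K) * (
         ((cnj (R v $ q $ p) * R v $ q $ p) * R v $ a $ b + cnj (R v $ q $ p) * (R v $ q $ a * R v $ p $ b)) / 2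
         - cnj (R v $ q $ p) * (R v $ a $ p * R v $ q $ b) / ?n))"
      unfolding Lap_entry[OF v] by (intro sum.cong refl) (simp only: Kp[OF v], simp add: field_simps)
    also have "\<dots> = - (1 / of_real K) * (
         ((\<Sum>q\<in>UNIV. \<Sum>p\<in>UNIV. cnj (R v $ q $ p) * R v $ q $ p) * R v $ a $ b + (\<Sum>q\<in>UNIV. \<Sum>p\<in>UNIV. cnj (R v $ q $ p) * (R v $ q $ a * R v $ p $ b))) / 2
         - (\<Sum>q\<in>UNIV. \<Sum>p\<in>UNIV. cnj (R v $ q $ p) * (R v $ a $ p * R v $ q $ b)) / ?n)"
      by (simp only: sum_distrib_left[symmetric] sum_subtractf sum_divide_distrib[symmetric] sum.distrib sum_distrib_right[symmetric])
    finally show ?thesis unfolding SU_sums[OF SU[OF v]] by (simp add: field_simps)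
  qed
  show ?thesis
    unfolding Phi_like_def
  proof (intro conjI ballI allI C2)
    fix v assume v: "v \<in> V"
    show "transpose (R v) = R v" using L_R[OF v] assms by simp
    show "matrix_inv (G v) $ i $ j = matrix_inv (G v) $ j $ i" for i j by (rule gram_inv_sym[OF v])
    show "Lap G (\<lambda>y. R y $ a $ b) v = - (2 / of_real (4 * K)) * (?n + 1 - 2 / ?n) * R v $ a $ b" for a b
      unfolding Lp[OF v] by (simp add: field_simps)
    show "Kap G (\<lambda>y. R y $ a $ b) (\<lambda>y. R y $ c' $ d) v
      = - (2 / of_real (4 * K)) * (R v $ a $ d * R v $ b $ c' + R v $ a $ c' * R v $ b $ d
          - 2 / ?n * (R v $ a $ b * R v $ c' $ d))" for a b c' d
      unfolding Kp[OF v] using sym[OF v, of c' b] sym[OF v, of c' a] by (simp add: field_simps)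
  qed
qed

text \<open>Both operators are computed on the entries of x first. The Leibniz rule carries them to
  x x^t, where the sums over the inner index close up to entries of Phi.\<close>

lemma Phi_like_Phi:
  assumes "L = (\<lambda>A. A)"
  shows "Phi_like K G V (\<lambda>y. Phi (R y))"
proof -
  let ?n = "of_nat CARD('n) :: complex"
  have Kp: "Kap G (\<lambda>y. R y $ a $ b) (\<lambda>y. R y $ p $ q) v
      = - (1 / of_real K) * (R v $ p $ b * R v $ a $ q - R v $ a $ b * R v $ p $ q / ?n)"
    if v: "v \<in> V" for v a b p q
    using Kap_trace[OF v, of "matrix_unit a b" p q] assms
    by (simp add: transpose_matrix_unit trace_matrix_unit sandwich_matrix_unit)
  have Lp: "Lap G (\<lambda>y. R y $ a $ b) v = - (1 / of_real K) * (?n - 1 / ?n) * R v $ a $ b"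
    if v: "v \<in> V" for v a b
  proof -
    have "Lap G (\<lambda>y. R y $ a $ b) v = (\<Sum>q\<in>UNIV. \<Sum>p\<in>UNIV. - (1 / of_real K) * (
         (cnj (R v $ q $ p) * R v $ q $ p) * R v $ a $ b
         - cnj (R v $ q $ p) * (R v $ a $ p * R v $ q $ b) / ?n))"
      unfolding Lap_entry[OF v] by (intro sum.cong refl) (simp only: Kp[OF v], simp add: field_simps)
    also have "\<dots> = - (1 / of_real K) * (
         (\<Sum>q\<in>UNIV. \<Sum>p\<in>UNIV. cnj (R v $ q $ p) * R v $ q $ p) * R v $ a $ b
         - (\<Sum>q\<in>UNIV. \<Sum>p\<in>UNIV. cnj (R v $ q $ p) * (R v $ a $ p * R v $ q $ b)) / ?n)"
      by (simp only: sum_distrib_left[symmetric] sum_subtractf sum_divide_distrib[symmetric] sum.distrib sum_distrib_right[symmetric])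
    finally show ?thesis unfolding SU_sums[OF SU[OF v]] by (simp add: field_simps)
  qed
  define P where "P = (\<lambda>y. Phi (R y))"
  have P: "P y $ a $ b = (\<Sum>e\<in>UNIV. R y $ a $ e * R y $ b $ e)" for y a b
    by (simp add: P_def Phi_def matrix_matrix_mult_def transpose_def)
  have Psym: "P y $ a $ b = P y $ b $ a" for y a b by (simp add: P mult.commute)
  have C2e: "Ck_on 2 V (\<lambda>y. R y $ a $ b)" for a b by (rule Ck_on_linear[OF V bounded_linear_entry C2])
  have C2P: "Ck_on 2 V P"
    unfolding P_def Phi_def
    by (rule Ck_on_bilinear[OF V bounded_bilinear_matrix_mult C2 Ck_on_linear[OF V bounded_linear_transpose C2]])
  show ?thesis
    unfolding Phi_like_def P_def[symmetric]
  proof (intro conjI ballI allI C2P)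
    fix v assume v: "v \<in> V"
    show gs: "matrix_inv (G v) $ i $ j = matrix_inv (G v) $ j $ i" for i j by (rule gram_inv_sym[OF v])
    show "transpose (P v) = P v" by (simp add: vec_eq_iff transpose_def) (metis Psym)
    have d: "(\<lambda>y. R y $ a $ b) differentiable (at v)" for a b
      using Ck_on_differentiable[OF C2e _ v] by simp
    have dd: "(\<lambda>y. R y $ a $ b * R y $ p $ q) differentiable (at v)" for a b p q
      by (rule differentiable_mult[OF d d])
    have KP: "Kap G (\<lambda>y. P y $ a $ b) h v = (\<Sum>e\<in>UNIV. R v $ a $ e * Kap G (\<lambda>y. R y $ b $ e) h v
        + R v $ b $ e * Kap G (\<lambda>y. R y $ a $ e) h v)" for a b h
      unfolding P Kap_sum_left[OF dd] by (simp only: Kap_mult_left[OF V v, of G, OF gs d d])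
    have KP1: "Kap G (\<lambda>y. R y $ a $ e) (\<lambda>y. P y $ p $ q) v
       = - (1 / of_real K) * (P v $ p $ a * R v $ q $ e + P v $ q $ a * R v $ p $ e - 2 * (P v $ p $ q * R v $ a $ e) / ?n)" for a e p q
    proof -
      have "Kap G (\<lambda>y. R y $ a $ e) (\<lambda>y. P y $ p $ q) v = (\<Sum>f\<in>UNIV. - (1 / of_real K) * (
          (R v $ p $ f * R v $ a $ f) * R v $ q $ e + (R v $ q $ f * R v $ a $ f) * R v $ p $ e
            - (2 * (R v $ p $ f * R v $ q $ f)) * R v $ a $ e / ?n))"
        unfolding Kap_commute[OF V v, of G, OF gs, of "\<lambda>y. R y $ a $ e"] KP
        by (intro sum.cong refl) (simp only: Kp[OF v], simp add: algebra_simps add_divide_distrib diff_divide_distrib)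
      also have "\<dots> = - (1 / of_real K) * (P v $ p $ a * R v $ q $ e + P v $ q $ a * R v $ p $ e
          - 2 * P v $ p $ q * R v $ a $ e / ?n)"
        unfolding P by (simp only: sum_distrib_left[symmetric] sum_subtractf sum_divide_distrib[symmetric]
            sum.distrib sum_distrib_right[symmetric])
      finally show ?thesis by (simp add: mult.assoc)
    qed
    show "Kap G (\<lambda>y. P y $ a $ b) (\<lambda>y. P y $ c' $ d) v
      = - (2 / of_real K) * (P v $ a $ d * P v $ b $ c' + P v $ a $ c' * P v $ b $ d
          - 2 / ?n * (P v $ a $ b * P v $ c' $ d))" for a b c' d
    proof -
      have "Kap G (\<lambda>y. P y $ a $ b) (\<lambda>y. P y $ c' $ d) v = (\<Sum>e\<in>UNIV. - (1 / of_real K) * (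
          P v $ c' $ b * (R v $ a $ e * R v $ d $ e) + P v $ d $ b * (R v $ a $ e * R v $ c' $ e)
          + P v $ c' $ a * (R v $ b $ e * R v $ d $ e) + P v $ d $ a * (R v $ b $ e * R v $ c' $ e)
          - 4 * P v $ c' $ d * (R v $ a $ e * R v $ b $ e) / ?n))"
        unfolding KP by (intro sum.cong refl) (simp only: KP1, simp add: algebra_simps add_divide_distrib diff_divide_distrib)
      also have "\<dots> = - (1 / of_real K) * (
          P v $ c' $ b * P v $ a $ d + P v $ d $ b * P v $ a $ c'
          + P v $ c' $ a * P v $ b $ d + P v $ d $ a * P v $ b $ c'
          - 4 * P v $ c' $ d * P v $ a $ b / ?n)"
        unfolding P[of v a d] P[of v a c'] P[of v b d] P[of v b c'] P[of v a b]
        by (simp only: sum_distrib_left[symmetric] sum_subtractf sum_divide_distrib[symmetric] sum.distrib)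
      finally show ?thesis
        unfolding Psym[of v c' b] Psym[of v d b] Psym[of v c' a] Psym[of v d a] by (simp add: field_simps)
    qed
    show "Lap G (\<lambda>y. P y $ a $ b) v = - (2 / of_real K) * (?n + 1 - 2 / ?n) * P v $ a $ b" for a b
    proof -
      have "Lap G (\<lambda>y. P y $ a $ b) v = (\<Sum>e\<in>UNIV. Lap G (\<lambda>y. R y $ a $ e * R y $ b $ e) v)"
        unfolding P by (rule Lap_sum[OF V v Ck_on_mult[OF V C2e C2e]])
      \<comment> \<open>Up to -1/K, the two factors contribute 2 (n - 1/n) through their own
        eigenvalues and 2 (1 - 1/n) through the cross term.\<close>
      also have "\<dots> = (\<Sum>e\<in>UNIV. (- (2 / of_real K) * (?n + 1 - 2 / ?n)) * (R v $ a $ e * R v $ b $ e))"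
        by (intro sum.cong refl)
          (simp only: Lap_mult[OF V v, of G, OF gs C2e C2e] Lp[OF v] Kp[OF v], simp add: algebra_simps add_divide_distrib diff_divide_distrib)
      finally show ?thesis by (simp only: P sum_distrib_left)
    qed
  qed
qed

end

section \<open>The isotropic quotient\<close>

text \<open>Expressed in the matrix Phi x alone, the map can be treated once for all
  \<open>Phi_like\<close> functions, on the group and on the quotient alike.\<close>

definition ratio :: "'n \<Rightarrow> 'n \<Rightarrow> complex^'n^'n \<Rightarrow> complex"
  where "ratio k l P = (P $ k $ l + \<i> * csqrt (P $ k $ k * P $ l $ l - (P $ k $ l)\<^sup>2)) / P $ l $ l"

lemma ratio_map_eq: "ratio_map k l x = ratio k l (Phi x)"
  by (simp add: ratio_map_def ratio_def Psi_def)

lemma ratio_harmonic_conformal: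
  fixes P :: "real^'d \<Rightarrow> complex^'n^'n"
  assumes V: "open V" "x \<in> V" and P: "Phi_like c G V P"
    and dom: "\<And>y. y \<in> V \<Longrightarrow> P y $ l $ l \<noteq> 0" "\<And>y. y \<in> V \<Longrightarrow> P y $ k $ k * P y $ l $ l - (P y $ k $ l)\<^sup>2 \<notin> \<real>\<^sub>\<le>\<^sub>0"
  shows "Ck_on 2 V (\<lambda>y. ratio k l (P y))" "Kap G (\<lambda>y. ratio k l (P y)) (\<lambda>y. ratio k l (P y)) x = 0"
    "Lap G (\<lambda>y. ratio k l (P y)) x = 0"
proof -
  let ?f = "\<lambda>y. ratio k l (P y)"
  let ?d = "\<lambda>y. P y $ k $ k * P y $ l $ l - (P y $ k $ l)\<^sup>2"
  have C: "Ck_on 2 V (\<lambda>y. P y $ a $ b)" for a b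
    by (rule Ck_on_linear[OF V(1) bounded_linear_entry]) (use P in \<open>simp add: Phi_like_def\<close>)
  have "Ck_on 2 V (\<lambda>y. P y $ k $ k * P y $ l $ l + (-1) * (P y $ k $ l * P y $ k $ l))"
    by (intro Ck_on_add[OF V(1)] Ck_on_mult[OF V(1)] Ck_on_const C)
  then have Cd: "Ck_on 2 V ?d" by (simp add: power2_eq_square)
  have "Ck_on 2 V (\<lambda>y. (P y $ k $ l + \<i> * csqrt (?d y)) * inverse (P y $ l $ l))"
    by (intro Ck_on_mult[OF V(1)] Ck_on_add[OF V(1)] Ck_on_const C Ck_on_csqrt[OF V(1) Cd dom(2)]
        Ck_on_inverse[OF V(1) C dom(1)])
  then show Cf: "Ck_on 2 V ?f" by (simp add: ratio_def field_class.field_divide_inverse)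
  have sym: "P x $ a $ b = P x $ b $ a" for a b
  proof -
    have "transpose (P x) $ a $ b = P x $ a $ b" using P V(2) by (simp add: Phi_like_def)
    then show ?thesis by (simp add: transpose_def)
  qed
  have t: "P y $ l $ l * ?f y - P y $ k $ l = \<i> * csqrt (?d y)" if "y \<in> V" for y
    using dom(1)[OF that] by (simp add: ratio_def)
  have root: "P y $ l $ l * (?f y)\<^sup>2 - 2 * P y $ k $ l * ?f y + P y $ k $ k = 0" if "y \<in> V" for y
  proof -
    have "(P y $ l $ l * ?f y - P y $ k $ l)\<^sup>2 = - ?d y"
      unfolding t[OF that] by (simp add: power_mult_distrib)
    \<comment> \<open>Completing the square costs a factor \<open>P y $ l $ l\<close>, which is
      nonzero on the domain.\<close>
    then have "P y $ l $ l * (P y $ l $ l * (?f y)\<^sup>2 - 2 * P y $ k $ l * ?f y + P y $ k $ k) = 0"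
      by (simp add: power2_eq_square algebra_simps)
    then show ?thesis using dom(1)[OF that] by simp
  qed
  have "csqrt (?d x) \<noteq> 0" using dom(2)[OF V(2)] by (metis csqrt_eq_0 nonpos_Reals_zero_I)
  then have ne: "P x $ l $ l * ?f x - P x $ k $ l \<noteq> 0" using t[OF V(2)] by simp
  have gs: "\<And>i j. matrix_inv (G x) $ i $ j = matrix_inv (G x) $ j $ i"
    using P V(2) by (simp add: Phi_like_def)
  have Lap: "Lap G (\<lambda>y. P y $ a $ b) x = (- (2 / of_real c) * (of_nat CARD('n) + 1 - 2 / of_nat CARD('n))) * P x $ a $ b" for a b
    using P V(2) by (simp add: Phi_like_def)
  have Kap: "Kap G (\<lambda>y. P y $ a $ b) (\<lambda>y. P y $ c' $ d) x
      = - (2 / of_real c) * (P x $ a $ d * P x $ b $ c' + P x $ a $ c' * P x $ b $ d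
          - 2 / of_nat CARD('n) * (P x $ a $ b * P x $ c' $ d))" for a b c' d
    using P V(2) by (simp add: Phi_like_def)
  note main = isotropic_root_harmonic_conformal[OF V, of G, OF gs C C C Cf root ne Lap Lap Lap,
      where \<mu> = "- (2 / of_real c)" and \<nu> = "2 / of_nat CARD('n)"]
  show "Kap G ?f ?f x = 0" 
    by (rule main(1)) (simp_all only: Kap, simp_all add: power2_eq_square sym[of l k] algebra_simps)
  show "Lap G ?f x = 0"
    by (rule main(2)) (simp_all only: Kap, simp_all add: power2_eq_square sym[of l k] algebra_simps)
qed

section \<open>Dimensions\<close>

lemma subspace_skew_hermitian: "subspace {X :: complex^'n^'n. herm X = - X}"
  by (auto simp: subspace_def herm_add herm_scaleR) (simp add: vec_eq_iff)

text \<open>The matrix \<open>mat \<i>\<close> has nonzero trace, so the trace condition costs at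
  least one dimension.\<close>

lemma dim_less_of_traceless:
  fixes S :: "(complex^'n^'n) set"
  assumes "subspace S" "mat \<i> \<in> S" "\<And>X. X \<in> S \<Longrightarrow> herm X = - X"
  shows "dim (su_alg \<inter> S) < dim S"
proof (rule dim_psubset)
  have "mat \<i> \<notin> su_alg \<inter> S" by (simp add: su_alg_def trace_mat_scalar)
  then have "su_alg \<inter> S \<subset> S" using assms(2) by blast
  then show "span (su_alg \<inter> S) \<subset> span S"
    by (metis assms(1) span_eq_iff subspace_inter subspace_su_alg)
qed

text \<open>Multiplication by i carries skew-Hermitian matrices to Hermitian ones, and only 0 is
  both. Two independent subspaces of equal dimension thus fit into real dimension 2 n^2.\<close>

lemma dim_su_alg: "dim (su_alg :: (complex^'n^'n) set) \<le> CARD('n)\<^sup>2 - 1"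
proof -
  let ?u = "{X :: complex^'n^'n. herm X = - X}"
  define J where "J = (\<lambda>X :: complex^'n^'n. \<chi> i j. \<i> * X $ i $ j)"
  have lin: "linear J" by (rule linearI) (simp_all add: J_def vec_eq_iff distrib_left)
  have inj: "inj J" by (rule injI) (simp add: J_def vec_eq_iff)
  have "?u \<inter> J ` ?u \<subseteq> {0}"
  proof
    fix Z assume "Z \<in> ?u \<inter> J ` ?u"
    then obtain X where X: "herm Z = - Z" "herm X = - X" "Z = J X" by auto
    have "herm (J X) = J X"
    proof -
      have "cnj (X $ j $ i) = - X $ i $ j" for i j using arg_cong[OF X(2), of "\<lambda>A. A $ i $ j"] by simp
      then show ?thesis by (simp add: J_def vec_eq_iff)
    qed
    then have "Z = - Z" using X by simp
    then show "Z \<in> {0}" by (simp add: vec_eq_iff eq_neg_iff_add_eq_0)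
  qed
  then have "dim (?u \<inter> J ` ?u) = 0" by (simp add: dim_eq_0)
  moreover have "dim (J ` ?u) = dim ?u"
    by (rule dim_image_eq[OF lin]) (use inj in \<open>simp add: inj_on_def\<close>)
  moreover have "dim {x + y |x y. x \<in> ?u \<and> y \<in> J ` ?u} + dim (?u \<inter> J ` ?u) = dim ?u + dim (J ` ?u)"
    by (rule dim_sums_Int[OF subspace_skew_hermitian linear_subspace_image[OF lin subspace_skew_hermitian]])
  moreover have "dim {x + y |x y. x \<in> ?u \<and> y \<in> J ` ?u} \<le> DIM(complex^'n^'n)" by (rule dim_subset_UNIV)
  moreover have "DIM(complex^'n^'n) = 2 * CARD('n)\<^sup>2" by (simp add: power2_eq_square)
  ultimately have "dim ?u \<le> CARD('n)\<^sup>2" by linarith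
  moreover have "dim (su_alg \<inter> ?u) < dim ?u"
    by (rule dim_less_of_traceless[OF subspace_skew_hermitian]) (auto simp: vec_eq_iff mat_def)
  moreover have "su_alg \<inter> ?u = su_alg" by (auto simp: su_alg_def)
  ultimately show ?thesis by simp
qed

text \<open>These pairs index the spanning matrices of \<open>dim_symmetric_su_alg\<close>; the
  singletons, where a = b, give the diagonal.\<close>

lemma card_unordered_pairs:
  "card {S. \<exists>a b :: 'n::finite. S = {a, b}} = CARD('n) + (CARD('n) choose 2)"
proof -
  have "S = {a, b} \<Longrightarrow> card S = 1 \<or> card S = 2" for S and a b :: 'n by (cases "a = b") auto
  moreover have "card S = 1 \<Longrightarrow> \<exists>a b. S = {a, b}" for S :: "'n set"
    by (metis card_1_singletonE insert_absorb2)
  moreover have "card S = 2 \<Longrightarrow> \<exists>a b. S = {a, b}" for S :: "'n set"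
    by (metis card_2_iff)
  ultimately have "{S. \<exists>a b :: 'n. S = {a, b}} = {S. S \<subseteq> UNIV \<and> card S = 1} \<union> {S. S \<subseteq> UNIV \<and> card S = 2}"
    by blast
  also have "card \<dots> = card {S. S \<subseteq> (UNIV :: 'n set) \<and> card S = 1} + card {S. S \<subseteq> (UNIV :: 'n set) \<and> card S = 2}"
    by (rule card_Un_disjoint) auto
  finally show ?thesis by (simp only: n_subsets finite choose_one)
qed

text \<open>A symmetric skew-Hermitian matrix has purely imaginary entries, which bounds the
  dimension by n (n + 1) / 2. The trace removes one, and n (n + 1) / 2 - 1 = (n - 1) (n + 2) /
  2.\<close>

lemma dim_symmetric_su_alg:
  "2 * dim (su_alg \<inter> {X :: complex^'n^'n. transpose X = X}) \<le> (CARD('n) - 1) * (CARD('n) + 2)"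
proof -
  let ?u = "{X :: complex^'n^'n. herm X = - X \<and> transpose X = X}"
  let ?PP = "{S. \<exists>a b :: 'n. S = {a, b}}"
  define E where "E = (\<lambda>S. \<chi> a b. if S = {a, b} then \<i> else 0 :: complex^'n^'n)"
  have sub: "subspace ?u"
    using subspace_skew_hermitian
    by (auto simp: subspace_def transpose_linear) (simp add: transpose_def vec_eq_iff)
  have "?u \<subseteq> span (E ` ?PP)"
  proof
    fix X assume "X \<in> ?u"
    then have X: "herm X $ a $ b = - X $ a $ b" "transpose X $ a $ b = X $ a $ b" for a b by auto
    then have Xs: "X $ a $ b = X $ b $ a" for a b by (simp add: transpose_def)
    have X0: "Re (X $ a $ b) = 0" for a b
      using arg_cong[OF X(1)[of a b], of Re] Xs[of a b] by simp
    \<comment> \<open>The value does not depend on how the pair is ordered, since X is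
      symmetric.\<close>
    define c where "c = (\<lambda>S. SOME z. \<exists>a b. S = {a, b} \<and> z = Im (X $ a $ b))"
    have c: "c {a, b} = Im (X $ a $ b)" for a b
    proof -
      have "\<exists>p q. {a, b} = {p, q} \<and> c {a, b} = Im (X $ p $ q)"
        unfolding c_def by (rule someI) blast
      then show ?thesis using Xs by (auto simp: doubleton_eq_iff)
    qed
    have "X = (\<Sum>S\<in>?PP. c S *\<^sub>R E S)"
    proof -
      have "(\<Sum>S\<in>?PP. c S *\<^sub>R E S) $ a $ b = X $ a $ b" for a b
      proof -
        have "(\<Sum>S\<in>?PP. c S *\<^sub>R E S) $ a $ b = (\<Sum>S\<in>?PP. if S = {a, b} then c {a, b} *\<^sub>R \<i> else 0)"
          unfolding sum_component by (rule sum.cong) (auto simp: E_def)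
        also have "\<dots> = c {a, b} *\<^sub>R \<i>" by (subst sum.delta) auto
        finally show ?thesis by (simp add: c complex_eq_iff X0)
      qed
      then show ?thesis by (simp add: vec_eq_iff)
    qed
    then show "X \<in> span (E ` ?PP)"
      by (metis (mono_tags, lifting) imageI span_base span_scale span_sum)
  qed
  then have "dim ?u \<le> card (E ` ?PP)" by (rule dim_le_card) simp
  also have "\<dots> \<le> CARD('n) + (CARD('n) choose 2)"
    unfolding card_unordered_pairs[symmetric] by (rule card_image_le) simp
  finally have "2 * dim ?u \<le> CARD('n) * (CARD('n) + 1)"
  proof -
    assume "dim ?u \<le> CARD('n) + (CARD('n) choose 2)"
    moreover have "2 * (CARD('n) choose 2) = CARD('n) * (CARD('n) - 1)"
      by (simp add: choose_two)
    ultimately show ?thesis by (cases "CARD('n)") auto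
  qed
  moreover have "dim (su_alg \<inter> ?u) < dim ?u"
    by (rule dim_less_of_traceless[OF sub]) (auto simp: vec_eq_iff mat_def transpose_def)
  moreover have "su_alg \<inter> ?u = su_alg \<inter> {X. transpose X = X}" by (auto simp: su_alg_def)
  ultimately show ?thesis by (cases "CARD('n)") auto
qed

text \<open>This turns a dimension count into surjectivity: the derivative of a chart is injective,
  so an upper bound on the dimension of the model space S forces its range to be the whole image of
  S under g.\<close>

lemma in_range_of_dim:
  fixes f :: "real^'d \<Rightarrow> 'b::euclidean_space" and g :: "'c::euclidean_space \<Rightarrow> 'b"
  assumes "linear f" "inj f" "linear g" "subspace S" "range f \<subseteq> g ` S" "dim S \<le> CARD('d)" "A \<in> g ` S"
  shows "A \<in> range f"
proof -
  have "dim (range f) = CARD('d)"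
    using dim_image_eq[OF assms(1), of UNIV] assms(2) by simp
  moreover have "dim (g ` S) \<le> dim S" by (rule dim_image_le[OF assms(3)])
  ultimately have "range f = g ` S"
    using assms by (intro subspace_dim_equal linear_subspace_image subspace_UNIV) auto
  then show ?thesis using assms(7) by simp
qed

section \<open>Charts\<close>

lemma neg_trace_form_eq_inner:
  "herm Y = - Y \<Longrightarrow> neg_trace_form c X Y = c * (X \<bullet> Y)"
  by (simp add: neg_trace_form_def inner_eq_Re_trace matrix_mult_minus trace_minus)

text \<open>Left multiplication by a unitary matrix is a Euclidean isometry, so the metric evaluated
  after translation to the identity is c times the pulled-back Euclidean one.\<close>

lemma SU_chart:
  fixes r :: "real^'d \<Rightarrow> complex^'n^'n"
  assumes c: "c > 0" and d: "CARD('d) = CARD('n)\<^sup>2 - 1"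
    and chart: "(V, r, G) \<in> atlas (SU_manifold c)"
  shows "Phi_like c G V (\<lambda>y. Phi (r y))"
proof -
  from chart have V: "open V" and r: "smooth_on V r" "r ` V \<subseteq> SU" and inj: "\<And>v. v \<in> V \<Longrightarrow> inj (left_derivative r v)"
    and G: "G = (\<lambda>v. \<chi> i j. neg_trace_form c (left_derivative r v (axis i 1)) (left_derivative r v (axis j 1)))"
    by (auto simp: SU_manifold_def)
  have SU: "r v \<in> SU" if "v \<in> V" for v using r that by auto
  have dr: "r differentiable (at v)" if "v \<in> V" for v by (rule smooth_on_differentiable[OF r(1) that])
  have D: "frechet_derivative r (at v) w = r v ** left_derivative r v w" if "v \<in> V" for v w
    by (simp add: left_derivative_def matrix_mul_assoc SU_herm[OF SU[OF that]])
  have su: "left_derivative r v w \<in> su_alg" if "v \<in> V" for v w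
    by (rule left_derivative_in_su_alg[OF V that r(2) dr[OF that]])
  interpret SU_immersion V r c G "\<lambda>A. A"
  proof
    show "open V" "c > 0" "(\<lambda>A. A) = (\<lambda>A. A) \<or> (\<lambda>A. A) = transpose" using V c by auto
    show "Ck_on 2 V r" by (rule smooth_on_Ck[OF r(1)])
    fix v assume v: "v \<in> V"
    show "r v \<in> SU" by (rule SU[OF v])
    show inj': "inj (frechet_derivative r (at v))"
      by (rule injI) (metis inj[OF v] left_derivative_def injD)
    show "G v = (\<chi> i j. c * (partial i r v \<bullet> partial j r v))"
      using su[OF v]
      by (simp add: G partial_def D[OF v] unitary_inner[OF SU_herm(2)[OF SU[OF v]]] neg_trace_form_eq_inner su_alg_def)
    fix A assume A: "herm (r v) ** A \<in> su_alg"
    show "A \<in> range (frechet_derivative r (at v))"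
    proof (rule in_range_of_dim[where g = "\<lambda>X. r v ** X" and S = su_alg])
      show "linear (frechet_derivative r (at v))" by (rule linear_frechet_derivative[OF dr[OF v]])
      show "linear ((**) (r v))" by (rule linearI) (simp_all add: matrix_add_ldistrib matrix_mult_scaleR)
      show "range (frechet_derivative r (at v)) \<subseteq> (**) (r v) ` su_alg" using D[OF v] su[OF v] by auto
      show "dim (su_alg :: (complex^'n^'n) set) \<le> CARD('d)" using dim_su_alg d by simp
      have "A = r v ** (herm (r v) ** A)" by (simp add: matrix_mul_assoc SU_herm[OF SU[OF v]])
      then show "A \<in> (**) (r v) ` su_alg" using A by blast
    qed (use inj' subspace_su_alg in auto)
  qed auto
  show ?thesis by (rule Phi_like_Phi) simp
qed

text \<open>The Cartan decomposition. On su(n) the transpose is minus the conjugate, so the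
  antisymmetric part is real and lies in \<open>so_alg\<close>, while the symmetric part is
  orthogonal to it.\<close>

lemma horizontal_eq:
  fixes X :: "complex^'n^'n"
  assumes "c > 0" "X \<in> su_alg"
  shows "horizontal c X = (1/2) *\<^sub>R (X + transpose X)"
  unfolding horizontal_def
proof (rule the_equality)
  let ?H = "(1/2) *\<^sub>R (X + transpose X)"
  have tX: "transpose X $ i $ j = - cnj (X $ i $ j)" for i j
  proof -
    have "herm X $ j $ i = - X $ j $ i" using assms(2) by (simp add: su_alg_def)
    then show ?thesis by (simp add: transpose_def)
  qed
  have skew: "herm Y = - Y" if "Y \<in> so_alg" for Y :: "complex^'n^'n"
  proof -
    have "cnj (Y $ i $ j) = Y $ i $ j" for i j
      using that by (simp add: so_alg_def Reals_cnj_iff)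
    then have "herm Y = transpose Y" by (simp add: vec_eq_iff transpose_def)
    then show ?thesis using that by (simp add: so_alg_def)
  qed
  have "X - ?H = (1/2) *\<^sub>R (X - transpose X)"
    by (simp add: vec_eq_iff algebra_simps complex_eq_iff)
  moreover have "(1/2) *\<^sub>R (X - transpose X) \<in> so_alg"
    unfolding so_alg_def
  proof (intro CollectI conjI allI)
    show "((1/2) *\<^sub>R (X - transpose X)) $ i $ j \<in> \<real>" for i j
      by (simp add: tX complex_is_Real_iff)
    show "transpose ((1/2) *\<^sub>R (X - transpose X)) = - ((1/2) *\<^sub>R (X - transpose X))"
      by (simp add: transpose_linear scaleR_diff_right)
  qed
  moreover have "neg_trace_form c ?H Y = 0" if "Y \<in> so_alg" for Y
  proof -
    have "trace (?H ** Y) = trace (transpose (?H ** Y))" by (simp add: trace_def transpose_def)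
    also have "\<dots> = - trace (Y ** ?H)"
      using that by (simp add: matrix_transpose_mul transpose_linear so_alg_def matrix_mult_minus trace_minus add.commute)
    also have "\<dots> = - trace (?H ** Y)" by (subst trace_mul_sym) simp
    finally have "trace (?H ** Y) = 0" by simp
    then show ?thesis by (simp add: neg_trace_form_def)
  qed
  ultimately show H: "X - ?H \<in> so_alg \<and> (\<forall>Y\<in>so_alg. neg_trace_form c ?H Y = 0)" by simp
  have sub: "subspace (so_alg :: (complex^'n^'n) set)"
    by (auto simp: subspace_def so_alg_def transpose_linear scaleR_conv_of_real[where 'a=complex])
      (simp add: transpose_def vec_eq_iff)
  fix H' assume H': "X - H' \<in> so_alg \<and> (\<forall>Y\<in>so_alg. neg_trace_form c H' Y = 0)"
  let ?D = "H' - ?H"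
  \<comment> \<open>Uniqueness: the difference of two candidates lies in \<open>so_alg\<close> and
    is orthogonal to it.\<close>
  have "?D = (X - ?H) - (X - H')" by simp
  then have D: "?D \<in> so_alg" using H H' subspace_diff[OF sub] by metis
  then have "c * (H' \<bullet> ?D) = 0" "c * (?H \<bullet> ?D) = 0"
    using H H' neg_trace_form_eq_inner[OF skew[OF D]] by metis+
  then have "?D \<bullet> ?D = 0" using assms(1) unfolding inner_diff_left[of H' ?H ?D] by simp
  then show "H' = ?H" by simp
qed

lemma Phi_in_SU: "x \<in> SU \<Longrightarrow> Phi x \<in> SU"
proof -
  assume x: "x \<in> SU"
  have "transpose x ** herm (transpose x) = mat 1"
    using arg_cong[OF SU_herm(2)[OF x], of transpose]
    by (simp add: matrix_transpose_mul transpose_herm transpose_mat)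
  then have "Phi x ** herm (Phi x) = mat 1"
    unfolding Phi_def herm_mult
    by (metis SU_herm(1)[OF x] matrix_mul_assoc matrix_mul_rid)
  moreover have "det (Phi x) = 1" using SU_herm(3)[OF x] by (simp add: Phi_def det_mul det_transpose)
  ultimately show ?thesis by (simp add: SU_def)
qed

lemma transpose_Phi: "transpose (Phi x) = Phi x"
  by (simp add: Phi_def matrix_transpose_mul)

text \<open>The Cartan embedding replaces the coset-valued chart by a matrix-valued immersion. The
  lift s belongs to the conclusion because the domain and the induced map are evaluated on
  it.\<close>

lemma SU_SO_chart:
  fixes r :: "real^'e \<Rightarrow> (complex^'n^'n) set"
  assumes c: "c > 0" and e: "2 * CARD('e) = (CARD('n) - 1) * (CARD('n) + 2)"
    and chart: "(V, r, G) \<in> atlas (SU_SO_manifold c)"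
  obtains s where "r = SO_coset \<circ> s" "s ` V \<subseteq> SU" "Phi_like c G V (\<lambda>y. Phi (s y))"
proof -
  from chart obtain s where rs: "r = SO_coset \<circ> s" and V: "open V" and s: "smooth_on V s" "s ` V \<subseteq> SU"
    and inj: "\<And>v. v \<in> V \<Longrightarrow> inj (\<lambda>w. horizontal c (left_derivative s v w))"
    and G: "G = (\<lambda>v. \<chi> i j. neg_trace_form c (horizontal c (left_derivative s v (axis i 1)))
                                        (horizontal c (left_derivative s v (axis j 1))))"
    by (auto simp: SU_SO_manifold_def)
  define P where "P = (\<lambda>y. Phi (s y))"
  have SU: "s v \<in> SU" if "v \<in> V" for v using s that by auto
  have ds: "s differentiable (at v)" if "v \<in> V" for v by (rule smooth_on_differentiable[OF s(1) that])
  have su: "left_derivative s v w \<in> su_alg" if "v \<in> V" for v w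
    by (rule left_derivative_in_su_alg[OF V that s(2) ds[OF that]])
  have hor: "horizontal c (left_derivative s v w) = (1/2) *\<^sub>R (left_derivative s v w + transpose (left_derivative s v w))"
    if "v \<in> V" for v w by (rule horizontal_eq[OF c su[OF that]])
  have tu: "transpose (s v) ** transpose (herm (s v)) = mat 1" "transpose (herm (s v)) ** transpose (s v) = mat 1" if "v \<in> V" for v
    using SU_herm[OF SU[OF that]] by (simp_all add: matrix_transpose_mul[symmetric] transpose_mat)
  have C2: "Ck_on 2 V P"
    unfolding P_def Phi_def
    by (rule Ck_on_bilinear[OF V bounded_bilinear_matrix_mult smooth_on_Ck[OF s(1)]
          Ck_on_linear[OF V bounded_linear_transpose smooth_on_Ck[OF s(1)]]])
  have dP: "P differentiable (at v)" if "v \<in> V" for v using Ck_on_differentiable[OF C2 _ that] by simp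
  \<comment> \<open>Differentiating s s^t adds X and its transpose, which is twice the horizontal
    part of X. The 2 is the origin of the factor c/4.\<close>
  have D: "frechet_derivative P (at v) w = 2 *\<^sub>R (s v ** horizontal c (left_derivative s v w) ** transpose (s v))"
    if v: "v \<in> V" for v w
  proof -
    let ?D = "frechet_derivative s (at v)" and ?X = "left_derivative s v w"
    have d: "(s has_derivative ?D) (at v)" using ds[OF v] frechet_derivative_works by blast
    have "(P has_derivative (\<lambda>w. s v ** transpose (?D w) + ?D w ** transpose (s v))) (at v)"
      unfolding P_def Phi_def
      by (rule bounded_bilinear.FDERIV[OF bounded_bilinear_matrix_mult d bounded_linear.has_derivative[OF bounded_linear_transpose d]])
    from frechet_derivative_at[OF this, symmetric]
    have "frechet_derivative P (at v) w = s v ** transpose (?D w) + ?D w ** transpose (s v)" by (rule fun_cong)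
    moreover have "?D w = s v ** ?X"
      by (simp add: left_derivative_def matrix_mul_assoc SU_herm[OF SU[OF v]])
    ultimately show ?thesis
      by (simp add: hor[OF v] matrix_transpose_mul matrix_add_ldistrib matrix_mult_add_left matrix_mult_scaleR
          matrix_mul_assoc add.commute)
  qed
  have sandwich_inner: "(s v ** A ** transpose (s v)) \<bullet> (s v ** B ** transpose (s v)) = A \<bullet> B" if v: "v \<in> V" for v A B
  proof -
    have "trace ((A ** transpose (s v)) ** herm (B ** transpose (s v))) = trace (A ** herm B)"
      unfolding herm_mult transpose_herm[symmetric] by (metis tu(1)[OF v] matrix_mul_assoc matrix_mul_rid)
    then show ?thesis
      unfolding matrix_mul_assoc[symmetric] unitary_inner[OF SU_herm(2)[OF SU[OF v]]]
      by (simp add: inner_eq_Re_trace matrix_mul_assoc)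
  qed
  let ?S = "su_alg \<inter> {X :: complex^'n^'n. transpose X = X}"
  have PSU: "P v \<in> SU" if "v \<in> V" for v unfolding P_def by (rule Phi_in_SU[OF SU[OF that]])
  have horS: "horizontal c (left_derivative s v w) \<in> ?S" if v: "v \<in> V" for v w
  proof -
    have "transpose X \<in> su_alg" if "X \<in> su_alg" for X :: "complex^'n^'n"
      using that by (simp add: su_alg_def transpose_herm[symmetric]) (simp add: transpose_def trace_def vec_eq_iff)
    then show ?thesis
      using su[OF v] unfolding hor[OF v]
      by (auto intro!: subspace_scale[OF subspace_su_alg] subspace_add[OF subspace_su_alg] simp: transpose_linear add.commute)
  qed
  interpret SU_immersion V P "c/4" G transpose
  proof
    show "open V" "c / 4 > 0" "transpose = (\<lambda>A. A) \<or> transpose = transpose" using V c by auto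
    show "Ck_on 2 V P" by (rule C2)
    fix v assume v: "v \<in> V"
    show "P v \<in> SU" by (rule PSU[OF v])
    show "transpose (P v) = P v" by (simp add: P_def transpose_Phi)
    have cancel: "herm (s v) ** (s v ** A ** transpose (s v)) ** transpose (herm (s v)) = A" for A
      by (metis SU_herm(2)[OF SU[OF v]] tu(1)[OF v] matrix_mul_assoc matrix_mul_lid matrix_mul_rid)
    show inj': "inj (frechet_derivative P (at v))"
    proof (rule injI)
      fix w w' assume "frechet_derivative P (at v) w = frechet_derivative P (at v) w'"
      then have "horizontal c (left_derivative s v w) = horizontal c (left_derivative s v w')"
        unfolding D[OF v] using cancel by (metis scaleR_cancel_left zero_neq_numeral)
      then show "w = w'" using inj[OF v] by (simp add: inj_def)
    qed
    show "G v = (\<chi> i j. c / 4 * (partial i P v \<bullet> partial j P v))"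
      using horS[OF v] by (simp add: G partial_def D[OF v] sandwich_inner[OF v] neg_trace_form_eq_inner su_alg_def)
    fix A assume A: "transpose A = A" "herm (P v) ** A \<in> su_alg"
    show "A \<in> range (frechet_derivative P (at v))"
    proof (rule in_range_of_dim[where g = "\<lambda>X. s v ** X ** transpose (s v)" and S = ?S])
      show "linear (frechet_derivative P (at v))" by (rule linear_frechet_derivative[OF dP[OF v]])
      show "linear (\<lambda>X. s v ** X ** transpose (s v))"
        by (rule linearI) (simp_all add: matrix_add_ldistrib matrix_mult_add_left matrix_mult_scaleR)
      show "subspace ?S"
        using subspace_su_alg by (intro subspace_inter) (auto simp: subspace_def transpose_linear transpose_def vec_eq_iff)
      show "range (frechet_derivative P (at v)) \<subseteq> (\<lambda>X. s v ** X ** transpose (s v)) ` ?S"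
      proof (rule image_subsetI)
        fix w
        have "2 *\<^sub>R horizontal c (left_derivative s v w) \<in> ?S"
          using horS[OF v, of w] subspace_scale[OF subspace_su_alg] by (auto simp: transpose_linear)
        then show "frechet_derivative P (at v) w \<in> (\<lambda>X. s v ** X ** transpose (s v)) ` ?S"
          unfolding D[OF v] by (intro image_eqI[of _ _ "2 *\<^sub>R horizontal c (left_derivative s v w)"])
            (simp_all add: matrix_mult_scaleR)
      qed
      show "dim ?S \<le> CARD('e)" using dim_symmetric_su_alg[where 'n='n] e by simp
      \<comment> \<open>A transported to the identity coset. By \<open>PA\<close>,
        \<open>herm (P v) ** A\<close> is unitarily similar to B, so membership in
        \<open>su_alg\<close> passes to B.\<close>
      define B where "B = herm (s v) ** A ** transpose (herm (s v))"
      have AB: "A = s v ** B ** transpose (s v)"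
        unfolding B_def by (metis SU_herm(1)[OF SU[OF v]] tu(2)[OF v] matrix_mul_assoc matrix_mul_lid matrix_mul_rid)
      have tB: "transpose B = B" by (simp add: B_def matrix_transpose_mul A(1) matrix_mul_assoc)
      have PA: "herm (P v) ** A = transpose (herm (s v)) ** B ** transpose (s v)"
        unfolding AB P_def Phi_def herm_mult transpose_herm[symmetric]
        by (metis SU_herm(2)[OF SU[OF v]] matrix_mul_assoc matrix_mul_rid)
      have B: "B = transpose (s v) ** (herm (P v) ** A) ** transpose (herm (s v))"
        unfolding PA by (metis tu(1)[OF v] matrix_mul_assoc matrix_mul_lid matrix_mul_rid)
      have "herm B = - B"
        using A(2) by (subst (1 2) B)
          (simp add: su_alg_def herm_mult transpose_herm[symmetric] matrix_mult_minus matrix_mul_assoc)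
      moreover have "trace B = trace (herm (P v) ** A)"
        unfolding PA by (metis tu(1)[OF v] matrix_mul_assoc matrix_mul_rid trace_mul_sym)
      ultimately have "B \<in> ?S" using A(2) tB by (simp add: su_alg_def)
      then show "A \<in> (\<lambda>X. s v ** X ** transpose (s v)) ` ?S" using AB by blast
    qed (use inj' in auto)
  qed
  have "Phi_like (4 * (c/4)) G V P" by (rule Phi_like_symmetric) simp
  then show ?thesis using that rs s(2) by (simp add: P_def)
qed

section \<open>Harmonic morphisms\<close>

lemma embedding_map_continuous: "embedding_map X Y f \<Longrightarrow> continuous_map X Y f"
  unfolding embedding_map_def by (metis homeomorphic_imp_continuous_map continuous_map_in_subtopology)

text \<open>Harmonicity has to be shown on the part of a chart domain that is mapped into W and
  further into U; \<open>conf\<close> therefore ranges over all open V' inside V whose image lies in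
  W.\<close>

lemma harmonic_morphismI:
  fixes M :: "('a, 'd::finite) riemannian" and \<phi> :: "'a \<Rightarrow> complex"
  assumes op: "\<And>U. open U \<Longrightarrow> openin (mtop M) {x\<in>W. \<phi> x \<in> U}"
    and chart: "\<And>V r G. (V, r, G) \<in> atlas M \<Longrightarrow> open V \<and> continuous_map (top_of_set V) (mtop M) r"
    and conf: "\<And>V r G V' x. (V, r, G) \<in> atlas M \<Longrightarrow> open V' \<Longrightarrow> V' \<subseteq> V \<Longrightarrow> r ` V' \<subseteq> W \<Longrightarrow> x \<in> V' \<Longrightarrow>
      Ck_on 2 V' (\<phi> \<circ> r) \<and> Lap G (\<phi> \<circ> r) x = 0 \<and> Kap G (\<phi> \<circ> r) (\<phi> \<circ> r) x = 0 \<and>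
      (\<forall>i j. matrix_inv (G x) $ i $ j = matrix_inv (G x) $ j $ i)"
  shows "harmonic_morphism M W complex_plane \<phi>"
  unfolding harmonic_morphism_def
proof (intro conjI allI impI)
  show "openin (mtop M) W" using op[of UNIV] by simp
  show "\<phi> ` W \<subseteq> topspace (mtop complex_plane)" by (simp add: complex_plane_def)
  fix U f assume U: "openin (mtop complex_plane) U" and f: "harmonic_on complex_plane U f"
  let ?W = "{x\<in>W. \<phi> x \<in> U}"
  have opW: "openin (mtop M) ?W" using U by (intro op) (simp add: complex_plane_def)
  have "Ck_on 2 {x\<in>V. r x \<in> ?W} ((f \<circ> \<phi>) \<circ> r) \<and> (\<forall>x\<in>V. r x \<in> ?W \<longrightarrow> laplacian G ((f \<circ> \<phi>) \<circ> r) x = 0)"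
    if a: "(V, r, G) \<in> atlas M" for V r G
  proof -
    let ?V = "{x\<in>V. r x \<in> ?W}"
    have "openin (top_of_set V) {x \<in> topspace (top_of_set V). r x \<in> ?W}"
      using chart[OF a] opW by (blast intro: openin_continuous_map_preimage)
    then have V: "open ?V" using chart[OF a] by (simp add: openin_open_eq)
    have img: "(\<phi> \<circ> r) ` ?V \<subseteq> U" by auto
    have c: "Ck_on 2 ?V (\<phi> \<circ> r)" "Lap G (\<phi> \<circ> r) x = 0" "Kap G (\<phi> \<circ> r) (\<phi> \<circ> r) x = 0"
      "\<And>i j. matrix_inv (G x) $ i $ j = matrix_inv (G x) $ j $ i" if "x \<in> ?V" for x
      using conf[OF a V _ _ that] by auto
    note h = harmonic_compose[OF V _ c(4) c(1) img c(2,3) f]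
    have "laplacian G ((f \<circ> \<phi>) \<circ> r) x = 0" if "x \<in> ?V" for x
      using h(2)[OF that that that that that] by (simp only: comp_assoc)
    moreover have "Ck_on 2 ?V ((f \<circ> \<phi>) \<circ> r)"
    proof (cases "?V = {}")
      \<comment> \<open>The facts \<open>c\<close> are available only at a point of the set; over
        the empty set the claim is vacuous.\<close>
      case True
      have "Ck_on k {} g" for k and g :: "real^'d \<Rightarrow> real" by (induction k arbitrary: g) auto
      then show ?thesis unfolding True .
    next
      case False
      then obtain x where x: "x \<in> ?V" by blast
      show ?thesis using h(1)[OF x x x x x] by (simp only: comp_assoc)
    qed
    ultimately show ?thesis by blast
  qed
  then show "harmonic_on M ?W (f \<circ> \<phi>)" unfolding harmonic_on_def using opW by blast
qed

text \<open>Here s is a chart of the group or the lift of a chart of the quotient, and \<phi> stands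
  for the respective map composed with the chart.\<close>

lemma ratio_map_chart:
  assumes "Phi_like c G V (\<lambda>y. Phi (s y))" "open V'" "V' \<subseteq> V" "s ` V' \<subseteq> W_hat k l" "x \<in> V'"
    and \<phi>: "\<And>y. \<phi> y = ratio_map k l (s y)"
  shows "Ck_on 2 V' \<phi> \<and> Lap G \<phi> x = 0 \<and> Kap G \<phi> \<phi> x = 0 \<and>
      (\<forall>i j. matrix_inv (G x) $ i $ j = matrix_inv (G x) $ j $ i)"
proof -
  have P: "Phi_like c G V' (\<lambda>y. Phi (s y))"
    using assms(1,3) Ck_on_subset unfolding Phi_like_def by blast
  have W: "s y \<in> W_hat k l" if "y \<in> V'" for y using assms(4) that by auto
  have "\<phi> = (\<lambda>y. ratio k l (Phi (s y)))" using \<phi> by (simp add: fun_eq_iff ratio_map_eq)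
  moreover have "\<forall>i j. matrix_inv (G x) $ i $ j = matrix_inv (G x) $ j $ i"
    using P assms(5) by (simp add: Phi_like_def)
  ultimately show ?thesis
    using ratio_harmonic_conformal[OF assms(2,5) P, of l k] W by (simp add: W_hat_def)
qed

text \<open>Excluding the branch cut makes the principal root continuous on
  \<open>W_hat k l\<close>. Taking U to be the whole plane gives openness of the domain.\<close>

lemma openin_ratio_map_preimage:
  fixes k l :: "'n::finite"
  assumes "open U"
  shows "openin (top_of_set SU) {x\<in>W_hat k l. ratio_map k l x \<in> U}"
proof -
  have cP: "continuous_on S (\<lambda>x :: complex^'n^'n. Phi x $ a $ b)" for S a b
    unfolding Phi_def matrix_matrix_mult_def transpose_def
    by (simp, intro continuous_intros)
  let ?g = "\<lambda>x :: complex^'n^'n. (Phi x $ l $ l, Phi x $ k $ k * Phi x $ l $ l - (Phi x $ k $ l)\<^sup>2)"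
  have "openin (top_of_set SU) (SU \<inter> ?g -` ((- {0}) \<times> (- \<real>\<^sub>\<le>\<^sub>0)))"
    by (rule continuous_openin_preimage_gen)
      (intro continuous_intros cP, intro open_Times, auto simp: open_Compl closed_nonpos_Reals_complex)
  moreover have "SU \<inter> ?g -` ((- {0}) \<times> (- \<real>\<^sub>\<le>\<^sub>0)) = W_hat k l"
    by (auto simp: W_hat_def)
  ultimately have W: "openin (top_of_set SU) (W_hat k l)" by simp
  have "continuous_on (- \<real>\<^sub>\<le>\<^sub>0) csqrt"
    by (rule continuous_at_imp_continuous_on) (use has_field_derivative_csqrt DERIV_isCont in blast)
  then have "continuous_on (W_hat k l) (\<lambda>x. csqrt (Phi x $ k $ k * Phi x $ l $ l - (Phi x $ k $ l)\<^sup>2))"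
    by (rule continuous_on_compose2) (intro continuous_intros cP, auto simp: W_hat_def)
  then have "continuous_on (W_hat k l) (ratio_map k l)"
    unfolding ratio_map_eq[abs_def] ratio_def
    by (intro continuous_intros cP) (auto simp: W_hat_def)
  then have "openin (top_of_set (W_hat k l)) (W_hat k l \<inter> ratio_map k l -` U)"
    using assms by (rule continuous_openin_preimage_gen)
  moreover have "W_hat k l \<inter> ratio_map k l -` U = {x\<in>W_hat k l. ratio_map k l x \<in> U}" by auto
  ultimately show ?thesis using openin_trans[OF _ W] by simp
qed

section \<open>Invariance under SO(n) and descent to the quotient\<close>

lemma SO_transpose:
  assumes "h \<in> SO"
  shows "herm h = transpose h" "h \<in> SU" "Phi (x ** h) = Phi x"
proof -
  show h: "herm h = transpose h"
    using assms by (simp add: SO_def vec_eq_iff transpose_def Reals_cnj_iff)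
  then show "h \<in> SU" using assms by (simp add: SO_def SU_def)
  show "Phi (x ** h) = Phi x"
    using assms unfolding Phi_def matrix_transpose_mul SO_def
    by (metis (mono_tags, lifting) matrix_mul_assoc matrix_mul_rid mem_Collect_eq)
qed

lemma SU_mult: "x \<in> SU \<Longrightarrow> y \<in> SU \<Longrightarrow> x ** y \<in> SU"
  by (simp add: SU_def det_mul herm_mult) (metis matrix_mul_assoc matrix_mul_rid)

lemma Phi_eq_of_SO_coset_eq:
  fixes x y :: "complex^'n^'n"
  assumes "SO_coset y = SO_coset x"
  shows "Phi y = Phi x"
proof -
  have "mat 1 \<in> (SO :: (complex^'n^'n) set)" 
    unfolding SO_def by (auto simp: transpose_mat) (simp add: mat_def)
  then have "x \<in> SO_coset x" unfolding SO_coset_def by (metis image_eqI matrix_mul_rid)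
  then obtain h where h: "h \<in> SO" "x = y ** h" using assms unfolding SO_coset_def by blast
  show ?thesis unfolding h(2) by (rule SO_transpose(3)[OF h(1), symmetric])
qed

theorem theorem6p1:
  fixes k l :: "'n::finite" and c :: real
  assumes "k \<noteq> l" and "c > 0"
    and "CARD('d::finite) = CARD('n)\<^sup>2 - 1"
    and "2 * CARD('e::finite) = (CARD('n) - 1) * (CARD('n) + 2)"
  shows "SO_invariant_on (SU :: (complex^'n^'n) set) Phi \<and>
    SO_invariant_on (SU :: (complex^'n^'n) set) Psi \<and>
    SO_invariant_on (W_hat k l) (ratio_map k l) \<and>
    harmonic_morphism (SU_manifold c :: (complex^'n^'n, 'd) riemannian)
      (W_hat k l) complex_plane (ratio_map k l) \<and>
    (\<exists>F. (\<forall>x \<in> W_hat k l. F (SO_coset x) = ratio_map k l x) \<and>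
      harmonic_morphism (SU_SO_manifold c :: ((complex^'n^'n) set, 'e) riemannian)
        (SO_coset ` W_hat k l) complex_plane F)"
proof (intro conjI)
  show "SO_invariant_on (SU :: (complex^'n^'n) set) Phi"
    "SO_invariant_on (SU :: (complex^'n^'n) set) Psi"
    "SO_invariant_on (W_hat k l) (ratio_map k l)"
    by (auto simp: SO_invariant_on_def W_hat_def SO_transpose SU_mult Psi_def ratio_map_def)
  show "harmonic_morphism (SU_manifold c :: (complex^'n^'n, 'd) riemannian)
      (W_hat k l) complex_plane (ratio_map k l)"
  proof (rule harmonic_morphismI)
    show "openin (mtop (SU_manifold c)) {x \<in> W_hat k l. ratio_map k l x \<in> U}" if "open U" for U
      using openin_ratio_map_preimage[OF that] by (simp add: SU_manifold_def)
    show "open V \<and> continuous_map (top_of_set V) (mtop (SU_manifold c)) r"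
      if "(V, r, G) \<in> atlas (SU_manifold c)" for V r and G :: "real^'d \<Rightarrow> real^'d^'d"
      using that by (auto simp: SU_manifold_def dest: embedding_map_continuous)
    fix V and r :: "real^'d \<Rightarrow> complex^'n^'n" and G V' x
    assume "(V, r, G) \<in> atlas (SU_manifold c)" and V': "open V'" "V' \<subseteq> V" "r ` V' \<subseteq> W_hat k l" "x \<in> V'"
    then have "Phi_like c G V (\<lambda>y. Phi (r y))" using SU_chart assms by blast
    from ratio_map_chart[OF this V']
    show "Ck_on 2 V' (ratio_map k l \<circ> r) \<and> Lap G (ratio_map k l \<circ> r) x = 0 \<and>
       Kap G (ratio_map k l \<circ> r) (ratio_map k l \<circ> r) x = 0 \<and>
       (\<forall>i j. matrix_inv (G x) $ i $ j = matrix_inv (G x) $ j $ i)" by simp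
  qed
  \<comment> \<open>The representative is arbitrary; \<open>ratio_map\<close> depends on x only
    through \<open>Phi x\<close>, which is constant on cosets.\<close>
  define F where "F = (\<lambda>S. ratio_map k l (SOME x. SO_coset x = S))"
  have F: "F (SO_coset x) = ratio_map k l x" for x
  proof -
    have "SO_coset (SOME y. SO_coset y = SO_coset x) = SO_coset x" by (rule someI) rule
    then show ?thesis unfolding F_def ratio_map_eq by (metis Phi_eq_of_SO_coset_eq)
  qed
  \<comment> \<open>The domain is a union of cosets, so membership can be tested on any
    representative.\<close>
  have W: "SO_coset x \<in> SO_coset ` W_hat k l \<longleftrightarrow> x \<in> W_hat k l" if "x \<in> SU" for x
  proof
    assume "SO_coset x \<in> SO_coset ` W_hat k l"
    then obtain y where "y \<in> W_hat k l" "SO_coset x = SO_coset y" by blast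
    then show "x \<in> W_hat k l" using Phi_eq_of_SO_coset_eq[of x y] that by (simp add: W_hat_def)
  qed simp
  have "harmonic_morphism (SU_SO_manifold c :: ((complex^'n^'n) set, 'e) riemannian)
        (SO_coset ` W_hat k l) complex_plane F"
  proof (rule harmonic_morphismI)
    show "openin (mtop (SU_SO_manifold c)) {S \<in> SO_coset ` W_hat k l. F S \<in> U}" if "open U" for U
    proof -
      have "{x\<in>SU. SO_coset x \<in> {S \<in> SO_coset ` W_hat k l. F S \<in> U}} = {x \<in> W_hat k l. ratio_map k l x \<in> U}"
        using W by (auto simp: F) (simp add: W_hat_def)
      moreover have "W_hat k l \<subseteq> SU" by (auto simp: W_hat_def)
      ultimately show ?thesis using openin_ratio_map_preimage[OF that, of k l]
        by (auto simp: SU_SO_manifold_def openin_SU_SO_top)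
    qed
    show "open V \<and> continuous_map (top_of_set V) (mtop (SU_SO_manifold c)) r"
      if "(V, r, G) \<in> atlas (SU_SO_manifold c)" for V r and G :: "real^'e \<Rightarrow> real^'e^'e"
      using that by (auto simp: SU_SO_manifold_def dest: embedding_map_continuous)
    fix V and r :: "real^'e \<Rightarrow> (complex^'n^'n) set" and G V' x
    assume a: "(V, r, G) \<in> atlas (SU_SO_manifold c)"
      and V': "open V'" "V' \<subseteq> V" "r ` V' \<subseteq> SO_coset ` W_hat k l" "x \<in> V'"
    obtain s where s: "r = SO_coset \<circ> s" "s ` V \<subseteq> SU" "Phi_like c G V (\<lambda>y. Phi (s y))"
      using SU_SO_chart[OF assms(2,4) a] by blast
    have sW: "s ` V' \<subseteq> W_hat k l"
    proof (rule image_subsetI)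
      fix y assume "y \<in> V'"
      then have "SO_coset (s y) \<in> SO_coset ` W_hat k l" "s y \<in> SU" using V'(2,3) s(1,2) by (auto simp: image_subset_iff)
      then show "s y \<in> W_hat k l" using W by simp
    qed
    show "Ck_on 2 V' (F \<circ> r) \<and> Lap G (F \<circ> r) x = 0 \<and> Kap G (F \<circ> r) (F \<circ> r) x = 0 \<and>
       (\<forall>i j. matrix_inv (G x) $ i $ j = matrix_inv (G x) $ j $ i)"
      by (rule ratio_map_chart[OF s(3) V'(1,2) sW V'(4)]) (simp add: s(1) F)
  qed
  with F show "\<exists>F. (\<forall>x \<in> W_hat k l. F (SO_coset x) = ratio_map k l x) \<and>
      harmonic_morphism (SU_SO_manifold c :: ((complex^'n^'n) set, 'e) riemannian)
        (SO_coset ` W_hat k l) complex_plane F" by blast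
qed

end
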